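(* Suppose the polyhedron $P$ is in general position, with bounding half-spaces $H_1,\dots,H_n$, and let $J\in\mathcal F$. Then there exists a neighborhood $U$ of the parameter $(\tilde a,\tilde b)$ in $\mathbf R^{d\times n}\times\mathbf R^n$ such that the equation $$ g^J(a,b) = \frac{1}{(2\pi)^{d/2}\sqrt{|\alpha_J(a)|}} \int_{V(J,a,b)} e^{-\frac{1}{2}\sum_{i=1}^dx_i^2} \prod_{j\in [n]\setminus J} H(f_j(a,b,x))\, \mu(dx) $$ holds for any $(a,b)\in U$.
   Context: Let $d,n\ge 1$, $[n]=\{1,\dots,n\}$, and let $\tilde a=(\tilde a_{ij})\in\mathbf R^{d\times n}$, $\tilde b=(\tilde b_1,\dots,\tilde b_n)^\top\in\mathbf R^n$. Set $H_j=\{x\in\mathbf R^d:\sum_{i=1}^d\tilde a_{ij}x_i+\tilde b_j\ge 0\}$ for $1\le j\le n$ and $P=\bigcap_{j=1}^nH_j$. Bounding half-spaces: $H_1,\dots,H_n$ are the bounding half-spaces of $P$ if $P$ has nonempty interior, every column of $\tilde a$ is nonzero, and the sets $F_j=P\cap\{x:\sum_{i}\tilde a_{ij}x_i+\tilde b_j=0\}$, $1\le j\le n$, are pairwise distinct and are exactly the facets of $P$. General position: put $\hat f_0(x_0,x)=x_0$ and $\hat f_j(x_0,x)=\sum_{i=1}^d\tilde a_{ij}x_i+\tilde b_jx_0$ $(1\le j\le n)$ for $(x_0,x)\in\mathbf R\times\mathbf R^d$, and let $\hat P=\{(x_0,x):\hat f_j(x_0,x)\ge0,\ 0\le j\le n\}$.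 With $H_1,\dots,H_n$ the bounding half-spaces of $P$, the polyhedron $P$ is in general position if for every $J\subset\{0,1,\dots,n\}$ such that some nonzero point of $\hat P$ satisfies $\hat f_j=0$ for all $j\in J$, the linear forms $\hat f_j$ $(j\in J)$ are linearly independent. $\mathcal F=\{J\subset[n]:\bigcap_{j\in J}F_j\neq\emptyset\}$ (with $\emptyset\in\mathcal F$) is the abstract simplicial complex associated with $P$. $H:\mathbf R\to\mathbf R$ is the Heaviside function, $H(x)=1$ for $x\ge0$ and $H(x)=0$ for $x<0$. For $a=(a_{ij})\in\mathbf R^{d\times n}$, $b\in\mathbf R^n$, $x\in\mathbf R^d$, put $f_j(a,b,x)=\sum_{i=1}^da_{ij}x_i+b_j$ and $$ \varphi(a,b)=\int_{\mathbf R^d}\frac{1}{(2\pi)^{d/2}}\exp\Bigl(-\frac12\sum_{i=1}^dx_i^2\Bigr)\sum_{F\in\mathcal F}\prod_{j\in F}\bigl(H(f_j(a,b,x))-1\bigr)\,dx . $$ For $J\in\mathcal F$, $g^J(a,b)=\bigl(\prod_{j\in J}\frac{\partial}{\partial b_j}\bigr)\varphi(a,b)$. Moreover $\alpha_J(a)=\bigl(\sum_{k=1}^da_{ki}a_{kj}\bigr)_{i,j\in J}$, $|\alpha_J(a)|$ is its determinant (equal to $1$ if $J=\emptyset$), $V(J,a,b)=\{x\in\mathbf R^d:\sum_{i=1}^da_{ij}x_i+b_j=0\ (j\in J)\}$, and $\mu$ is the volume element (Lebesgue measure induced from the Euclidean metric; unit point mass in dimension $0$) of the affine subspace $V(J,a,b)$.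 *)

theory Defs
  imports "HOL-Analysis.Analysis"
begin

definition lin_fun :: "real^'n^'d \<Rightarrow> real^'n \<Rightarrow> 'n \<Rightarrow> real^'d \<Rightarrow> real" where
  "lin_fun a b j x = (\<Sum>i\<in>UNIV. a $ i $ j * x $ i) + b $ j"

definition half_space :: "real^'n^'d \<Rightarrow> real^'n \<Rightarrow> 'n \<Rightarrow> (real^'d) set" where
  "half_space a b j = {x. lin_fun a b j x \<ge> 0}"

definition P_set :: "real^'n^'d \<Rightarrow> real^'n \<Rightarrow> (real^'d) set" where
  "P_set a b = (\<Inter>j. half_space a b j)"

definition F_set :: "real^'n^'d \<Rightarrow> real^'n \<Rightarrow> 'n \<Rightarrow> (real^'d) set" where
  "F_set a b j = P_set a b \<inter> {x. lin_fun a b j x = 0}"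

definition bounding_half_spaces :: "real^'n^'d \<Rightarrow> real^'n \<Rightarrow> bool" where
  "bounding_half_spaces a b \<longleftrightarrow>
     interior (P_set a b) \<noteq> {} \<and>
     (\<forall>j. column j a \<noteq> 0) \<and>
     inj (F_set a b) \<and>
     range (F_set a b) = {F. F facet_of P_set a b}"

text \<open>Homogenization: the index set \<open>{0, 1, \<dots>, n}\<close> is \<open>'n option\<close>, with \<open>None\<close> in the role of \<open>0\<close>.\<close>

fun hom_form :: "real^'n^'d \<Rightarrow> real^'n \<Rightarrow> 'n option \<Rightarrow> real \<times> (real^'d) \<Rightarrow> real" where
  "hom_form a b None (x0, x) = x0"
| "hom_form a b (Some j) (x0, x) = (\<Sum>i\<in>UNIV. a $ i $ j * x $ i) + b $ j * x0"

definition hom_cone :: "real^'n^'d \<Rightarrow> real^'n \<Rightarrow> (real \<times> (real^'d)) set" where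
  "hom_cone a b = {z. \<forall>j. hom_form a b j z \<ge> 0}"

text \<open>Linear independence of an indexed family (so a repeated form counts as dependent).\<close>

definition lin_indep_family :: "'i set \<Rightarrow> ('i \<Rightarrow> 'v \<Rightarrow> real) \<Rightarrow> bool" where
  "lin_indep_family J f \<longleftrightarrow>
     (\<forall>c. (\<forall>z. (\<Sum>j\<in>J. c j * f j z) = 0) \<longrightarrow> (\<forall>j\<in>J. c j = 0))"

definition general_position :: "real^'n^'d \<Rightarrow> real^'n \<Rightarrow> bool" where
  "general_position a b \<longleftrightarrow>
     (\<forall>J. (\<exists>z\<in>hom_cone a b. z \<noteq> 0 \<and> (\<forall>j\<in>J. hom_form a b j z = 0))
          \<longrightarrow> lin_indep_family J (hom_form a b))"

text \<open>The empty index set belongs to the complex, since \<open>\<Inter>{} = UNIV\<close>.\<close>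

definition simp_complex :: "real^'n^'d \<Rightarrow> real^'n \<Rightarrow> 'n set set" where
  "simp_complex a b = {J. (\<Inter>j\<in>J. F_set a b j) \<noteq> {}}"

definition heaviside :: "real \<Rightarrow> real" where
  "heaviside x = (if x \<ge> 0 then 1 else 0)"

definition phi :: "'n set set \<Rightarrow> (real^'n^'d) \<times> (real^'n) \<Rightarrow> real" where
  "phi \<F> = (\<lambda>(a, b). \<integral>x. 1 / (2 * pi) powr (real CARD('d) / 2)
       * exp (- (1 / 2) * (\<Sum>i\<in>UNIV. (x $ i)\<^sup>2))
       * (\<Sum>F\<in>\<F>. \<Prod>j\<in>F. (heaviside (lin_fun a b j x) - 1)) \<partial>lborel)"

definition partial_b :: "'n \<Rightarrow> ('c \<times> (real^'n) \<Rightarrow> real) \<Rightarrow> 'c \<times> (real^'n) \<Rightarrow> real" where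
  "partial_b j f = (\<lambda>(a, b). deriv (\<lambda>t. f (a, b + t *\<^sub>R axis j 1)) 0)"

definition has_partial_b :: "'n \<Rightarrow> ('c \<times> (real^'n) \<Rightarrow> real) \<Rightarrow> 'c \<times> (real^'n) \<Rightarrow> bool" where
  "has_partial_b j f = (\<lambda>(a, b). (\<lambda>t. f (a, b + t *\<^sub>R axis j 1)) field_differentiable at 0)"

text \<open>The operator \<open>\<partial>/\<partial>b\<^bsub>j1\<^esub> \<cdots> \<partial>/\<partial>b\<^bsub>jk\<^esub>\<close> for a list \<open>[j1, \<dots>, jk]\<close>; the last one
  in the list is applied first. As \<open>deriv\<close> is total, existence of all the derivatives involved
  is recorded separately by \<open>iter_partials_exist\<close>, which is meant for open sets.\<close>

primrec iter_partial_b :: "'n list \<Rightarrow> ('c \<times> (real^'n) \<Rightarrow> real) \<Rightarrow> 'c \<times> (real^'n) \<Rightarrow> real" where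
  "iter_partial_b [] f = f"
| "iter_partial_b (j # js) f = partial_b j (iter_partial_b js f)"

primrec iter_partials_exist ::
    "'n list \<Rightarrow> ('c \<times> (real^'n) \<Rightarrow> real) \<Rightarrow> ('c \<times> (real^'n)) set \<Rightarrow> bool" where
  "iter_partials_exist [] f U \<longleftrightarrow> True"
| "iter_partials_exist (j # js) f U \<longleftrightarrow>
     iter_partials_exist js f U \<and> (\<forall>p\<in>U. has_partial_b j (iter_partial_b js f) p)"

text \<open>Determinant of a square matrix indexed by a finite set (Leibniz formula, as in the
  library's \<open>det\<close>, whose index set is a whole type). For \<open>J = {}\<close> it is \<open>1\<close>.\<close>

definition det_on :: "'i set \<Rightarrow> ('i \<Rightarrow> 'i \<Rightarrow> real) \<Rightarrow> real" where
  "det_on J M = (\<Sum>p | p permutes J. of_int (sign p) * (\<Prod>i\<in>J. M i (p i)))"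

definition gram :: "real^'n^'d \<Rightarrow> 'n \<Rightarrow> 'n \<Rightarrow> real" where
  "gram a i j = (\<Sum>k\<in>UNIV. a $ k $ i * a $ k $ j)"

definition V_set :: "'n set \<Rightarrow> real^'n^'d \<Rightarrow> real^'n \<Rightarrow> (real^'d) set" where
  "V_set J a b = {x. \<forall>j\<in>J. lin_fun a b j x = 0}"

text \<open>Volume measure of a nonempty affine subspace \<open>V\<close>: image of the product of one-dimensional
  Lebesgue measures under the Euclidean coordinates given by an origin \<open>c\<close> and an orthonormal
  basis \<open>B\<close> of the direction space. It does not depend on the frame chosen, because Lebesgue
  measure is invariant under isometries. In dimension \<open>0\<close>, \<open>B\<close> is empty, the product measure
  is the unit mass on a one-point space, and the image is the unit mass at \<open>c\<close>.\<close>

definition orthonormal_frame :: "'a::euclidean_space set \<Rightarrow> 'a \<Rightarrow> 'a set \<Rightarrow> bool" where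
  "orthonormal_frame V c B \<longleftrightarrow>
     pairwise orthogonal B \<and> (\<forall>u\<in>B. norm u = 1) \<and> V = (\<lambda>y. c + y) ` span B"

definition frame_volume :: "'a::euclidean_space \<Rightarrow> 'a set \<Rightarrow> 'a measure" where
  "frame_volume c B =
     distr (\<Pi>\<^sub>M u\<in>B. (lborel :: real measure)) borel (\<lambda>t. c + (\<Sum>u\<in>B. t u *\<^sub>R u))"

definition affine_volume :: "'a::euclidean_space set \<Rightarrow> 'a measure" where
  "affine_volume V =
     (case (SOME (c, B). orthonormal_frame V c B) of (c, B) \<Rightarrow> frame_volume c B)"

lemma orthonormal_frame_exists:
  fixes V :: "'a::euclidean_space set"
  assumes "affine V" "V \<noteq> {}"
  shows "\<exists>c B. orthonormal_frame V c B"
proof -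
  obtain c where c: "c \<in> V" using assms(2) by blast
  have "subspace ((\<lambda>x. - c + x) ` V)"
    using affine_diffs_subspace[OF assms(1) c] by simp
  then obtain B where B: "pairwise orthogonal B" "\<And>u. u \<in> B \<Longrightarrow> norm u = 1"
    "span B = (\<lambda>x. - c + x) ` V"
    by (metis orthonormal_basis_subspace)
  have "V = (\<lambda>y. c + y) ` span B"
    unfolding B(3) by (simp add: image_image)
  with B(1,2) show ?thesis unfolding orthonormal_frame_def by blast
qed

end

theory Submission
  imports Defs "HOL-Probability.Distributions"
begin

text \<open>
  Call \<open>(a, b)\<close> regular if it has exactly the faces in \<open>\<F>\<close> and every face \<open>L \<in> \<F>\<close> has a point where
  precisely the forms in \<open>L\<close> vanish, with independent normals. General position makes this an open
  condition: non-faces stay non-faces by compactness of the unit sphere in the homogenized space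
  (this is where the behaviour at infinity enters), and faces persist by Cramer's rule.

  At a regular parameter the alternating sum in \<open>\<phi>\<close> is the indicator function of the polyhedron. For
  \<open>x\<close> outside, walk from a relative interior point of a face towards \<open>x\<close>; splitting off the
  hyperplanes crossed last expresses the sum through sums with fewer violated inequalities.

  Each derivative \<open>\<partial>/\<partial>b\<^sub>j\<close> then moves one facet hyperplane of the integral over \<open>V(J, a, b)\<close>. In an
  orthonormal frame of \<open>V(J)\<close> whose first vector is the normalized component \<open>q\<close> of the \<open>j\<close>-th normal
  orthogonal to the normals in \<open>J\<close>, Fubini's theorem and the fundamental theorem of calculus give
  the integral over \<open>V(J \<union> {j})\<close> divided by \<open>|q|\<close>, and the Gram determinant grows by the factor \<open>|q|\<^sup>2\<close>.
\<close>

subsection \<open>The alternating sum over visible faces\<close>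

text \<open>Toggling a fixed element \<open>j\<close> of \<open>T\<close> pairs off subsets whose
  cardinalities differ by one.\<close>

lemma sum_Pow_alternating:
  assumes "finite T" "T \<noteq> {}"
  shows "(\<Sum>G\<in>Pow T. (-1) ^ card G) = (0::real)"
proof -
  obtain j T' where T: "T = insert j T'" "j \<notin> T'"
    using assms by (meson Set.set_insert ex_in_conv)
  have fin: "finite T'" using assms T by simp
  have "inj_on (insert j) (Pow T')"
    using T(2) by (intro inj_onI) (auto simp: insert_ident)
  moreover have "card (insert j G) = Suc (card G)" if "G \<in> Pow T'" for G
    using that T(2) fin finite_subset by (subst card_insert_disjoint) auto
  ultimately have "(\<Sum>G\<in>insert j ` Pow T'. (-1) ^ card G) = (\<Sum>G\<in>Pow T'. - ((-1::real) ^ card G))"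
    by (subst sum.reindex) auto
  moreover have "Pow T' \<inter> insert j ` Pow T' = {}" using T(2) by auto
  ultimately show ?thesis
    unfolding T(1) Pow_insert using fin by (subst sum.union_disjoint) (auto simp: sum_negf)
qed

lemma sum_Pow_Un_disjoint:
  fixes g :: "'i set \<Rightarrow> real"
  assumes "finite A" "finite B" "A \<inter> B = {}"
  shows "sum g (Pow (A \<union> B)) = (\<Sum>G\<in>Pow A. \<Sum>F\<in>Pow B. g (F \<union> G))"
proof -
  have "sum g (Pow (A \<union> B)) = (\<Sum>(G, F)\<in>Pow A \<times> Pow B. g (F \<union> G))"
    by (rule sum.reindex_bij_witness[where i = "\<lambda>(G, F). F \<union> G" and j = "\<lambda>H. (H \<inter> A, H \<inter> B)"])
      (use assms(3) in \<open>auto intro!: arg_cong[where f = g]\<close>)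
  then show ?thesis by (simp add: sum.cartesian_product)
qed

text \<open>
  The induction splits \<open>F\<close> into its part among the hyperplanes \<open>T\<close> crossed last and the rest. Treating
  all of \<open>T\<close> at once avoids any genericity assumption on the path.
\<close>
lemma visible_faces_alternating_sum:
  fixes f :: "'i::finite \<Rightarrow> 'a::real_vector \<Rightarrow> real"
  assumes aff: "\<And>j x y t. f j ((1 - t) *\<^sub>R x + t *\<^sub>R y) = (1 - t) * f j x + t * f j y"
    and strict: "\<And>L. L \<in> K \<Longrightarrow> \<exists>y. (\<forall>j\<in>L. f j y = 0) \<and> (\<forall>j. j \<notin> L \<longrightarrow> f j y > 0)"
    and active: "\<And>L x. (\<forall>j. f j x \<ge> 0) \<Longrightarrow> (\<forall>j\<in>L. f j x = 0) \<Longrightarrow> L \<in> K"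
    and "L \<in> K" "\<forall>j\<in>L. f j x = 0" "{j. f j x < 0} \<noteq> {}"
  shows "(\<Sum>F\<in>Pow {j. f j x < 0}. if F \<union> L \<in> K then (-1) ^ card F else 0) = (0::real)"
  using assms(4-6)
proof (induction "card {j. f j x < 0}" arbitrary: L x rule: less_induct)
  case less
  \<comment> \<open>A relative interior point of the face \<open>A\<close> also lies on the face
    \<open>B\<close>, so \<open>active\<close> applies there.\<close>
  have down: "B \<in> K" if A: "A \<in> K" "B \<subseteq> A" for A B
  proof -
    obtain y where y: "\<forall>j\<in>A. f j y = 0" "\<forall>j. j \<notin> A \<longrightarrow> f j y > 0"
      using strict[OF A(1)] by blast
    have "\<forall>j. f j y \<ge> 0" using y by (metis less_eq_real_def)
    then show ?thesis using active[of y B] y A(2) by auto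
  qed
  obtain y where y0: "\<forall>j\<in>L. f j y = 0" and y1: "\<forall>j. j \<notin> L \<longrightarrow> f j y > 0"
    using strict[OF less.prems(1)] by blast
  define N where "N = {j. f j x < 0}"
  \<comment> \<open>For \<open>j\<close> in \<open>N\<close>, \<open>\<tau> j\<close> is the
    parameter at which the segment from \<open>y\<close> to \<open>x\<close> meets the zero set of
    \<open>f j\<close>. The last such parameter is \<open>m\<close>, attained exactly by the indices
    in \<open>T\<close>, and \<open>z\<close> is the point reached there.\<close>
  define \<tau> where "\<tau> j = f j y / (f j y - f j x)" for j
  define m where "m = Max (\<tau> ` N)"
  define T where "T = {j\<in>N. \<tau> j = m}"
  define z where "z = (1 - m) *\<^sub>R y + m *\<^sub>R x"
  have Nne: "N \<noteq> {}" and fin: "finite N" using less.prems by (auto simp: N_def)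
  have NL: "j \<notin> L" if "j \<in> N" for j using that less.prems(2) by (auto simp: N_def)
  have \<tau>01: "0 < \<tau> j" "\<tau> j < 1" if "j \<in> N" for j
    using y1 NL[OF that] that by (auto simp: \<tau>_def N_def field_simps)
  have "m \<in> \<tau> ` N" unfolding m_def using Nne fin by (intro Max_in) auto
  then obtain j0 where j0: "j0 \<in> N" "\<tau> j0 = m" by blast
  then have m01: "0 < m" "m < 1" and Tne: "T \<noteq> {}" using \<tau>01[of j0] by (auto simp: T_def)
  have \<tau>m: "\<tau> j \<le> m" if "j \<in> N" for j using that fin by (auto simp: m_def)
  have fz: "f j z = (1 - m) * f j y + m * f j x" for j unfolding z_def by (rule aff)
  have fzN: "f j z = (\<tau> j - m) * (f j y - f j x)" and pos: "f j y - f j x > 0" if "j \<in> N" for j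
  proof -
    show pos: "f j y - f j x > 0" using y1 NL[OF that] that by (auto simp: N_def intro: less_trans)
    have "\<tau> j * (f j y - f j x) = f j y" using pos by (simp add: \<tau>_def)
    then show "f j z = (\<tau> j - m) * (f j y - f j x)" unfolding fz by (simp add: algebra_simps)
  qed
  have zL: "f j z = 0" if "j \<in> L" for j using that y0 less.prems(2) by (simp add: fz)
  have zT: "f j z = 0" if "j \<in> T" for j using that fzN by (auto simp: T_def)
  have zNT: "f j z < 0" if "j \<in> N - T" for j
    using that fzN[of j] pos[of j] \<tau>m[of j] by (auto simp: T_def mult_less_0_iff)
  have znN: "f j z \<ge> 0" if "j \<notin> N" for j
  proof -
    have "f j y \<ge> 0" by (cases "j \<in> L") (use y0 y1 in \<open>auto intro: less_imp_le\<close>)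
    moreover have "f j x \<ge> 0" using that by (auto simp: N_def)
    ultimately show ?thesis unfolding fz using m01 by simp
  qed
  \<comment> \<open>At \<open>z\<close> the inequalities crossed before \<open>m\<close> are already
    violated, and those in \<open>T\<close> hold with equality.\<close>
  have negz: "{j. f j z < 0} = N - T"
  proof (intro set_eqI iffI)
    fix j assume "j \<in> {j. f j z < 0}"
    then show "j \<in> N - T" using znN[of j] zT[of j] by (cases "j \<in> N"; cases "j \<in> T") auto
  qed (use zNT in auto)
  have TN: "T \<subseteq> N" by (auto simp: T_def)
  define S where "S L' N' = (\<Sum>F\<in>Pow N'. if F \<union> L' \<in> K then (-1) ^ card F else (0::real))" for L' N'
  have "S L N = (\<Sum>G\<in>Pow T. \<Sum>F\<in>Pow (N - T). if (F \<union> G) \<union> L \<in> K then (-1) ^ card (F \<union> G) else 0)"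
    using sum_Pow_Un_disjoint[of T "N - T" "\<lambda>H. if H \<union> L \<in> K then (-1) ^ card H else 0"] TN
    by (simp add: S_def Un_absorb1)
  also have "\<dots> = (\<Sum>G\<in>Pow T. (-1) ^ card G * S (L \<union> G) (N - T))"
    unfolding S_def sum_distrib_left
  proof (intro sum.cong refl)
    fix G F assume GF: "G \<in> Pow T" "F \<in> Pow (N - T)"
    have "card (F \<union> G) = card F + card G"
      using GF by (intro card_Un_disjoint) auto
    moreover have "(F \<union> G) \<union> L = F \<union> (L \<union> G)" by blast
    ultimately show "(if (F \<union> G) \<union> L \<in> K then (-1) ^ card (F \<union> G) else 0) =
        (-1) ^ card G * (if F \<union> (L \<union> G) \<in> K then (-1) ^ card F else (0::real))"
      by (simp add: power_add)
  qed
  \<comment> \<open>If \<open>N = T\<close>, then \<open>z\<close> lies in the polyhedron, each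
    \<open>L \<union> G\<close> is a face, every inner sum is 1, and the alternating sum over
    \<open>Pow T\<close> vanishes. Otherwise each inner sum vanishes: by induction at
    \<open>z\<close> if \<open>L \<union> G\<close> is in \<open>K\<close>, by downward closure if
    not.\<close>
  also have "\<dots> = 0"
  proof (cases "N = T")
    case True
    have "S (L \<union> G) (N - T) = 1" if "G \<in> Pow T" for G
    proof -
      have "L \<union> G \<in> K"
      proof (rule active)
        show "\<forall>j. 0 \<le> f j z" using negz True by (auto simp: not_less[symmetric])
        show "\<forall>j\<in>L \<union> G. f j z = 0" using that zL zT by auto
      qed
      then show ?thesis by (simp add: S_def True)
    qed
    then show ?thesis using sum_Pow_alternating[of T] Tne by simp
  next
    case False
    have "S (L \<union> G) (N - T) = 0" if G: "G \<in> Pow T" for G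
    proof (cases "L \<union> G \<in> K")
      case True
      have "card {j. f j z < 0} < card {j. f j x < 0}"
        unfolding negz N_def[symmetric] using fin Tne by (intro psubset_card_mono) (auto simp: T_def)
      moreover have "{j. f j z < 0} \<noteq> {}" using negz False by (auto simp: T_def)
      moreover have "\<forall>j\<in>L \<union> G. f j z = 0" using G zL zT by auto
      ultimately show ?thesis using less.hyps[of z "L \<union> G"] True by (simp add: S_def negz)
    next
      case False
      then have "F \<union> (L \<union> G) \<notin> K" for F using down[of "F \<union> (L \<union> G)" "L \<union> G"] by auto
      then show ?thesis by (simp add: S_def)
    qed
    then show ?thesis by simp
  qed
  finally show ?case by (simp add: S_def N_def)
qed

text \<open>A factor of the product is -1 at a violated inequality and 0 otherwise, so only faces
  inside the violated set contribute, with sign \<open>(-1) ^ card F\<close>. The preceding lemma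
  with \<open>L = {}\<close> then settles points outside the polyhedron; inside it only the empty
  face remains.\<close>

lemma sum_heaviside_faces:
  fixes f :: "'i::finite \<Rightarrow> 'a::real_vector \<Rightarrow> real"
  assumes aff: "\<And>j x y t. f j ((1 - t) *\<^sub>R x + t *\<^sub>R y) = (1 - t) * f j x + t * f j y"
    and strict: "\<And>L. L \<in> K \<Longrightarrow> \<exists>y. (\<forall>j\<in>L. f j y = 0) \<and> (\<forall>j. j \<notin> L \<longrightarrow> f j y > 0)"
    and active: "\<And>L x. (\<forall>j. f j x \<ge> 0) \<Longrightarrow> (\<forall>j\<in>L. f j x = 0) \<Longrightarrow> L \<in> K"
    and "{} \<in> K"
  shows "(\<Sum>F\<in>K. \<Prod>j\<in>F. (heaviside (f j x) - 1)) = (\<Prod>j\<in>UNIV. heaviside (f j x))"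
proof -
  let ?N = "{j. f j x < 0}"
  have "(\<Prod>j\<in>F. (heaviside (f j x) - 1)) = (if F \<subseteq> ?N then (-1) ^ card F else 0)" for F
  proof (cases "F \<subseteq> ?N")
    case True
    then have "(\<Prod>j\<in>F. (heaviside (f j x) - 1)) = (\<Prod>j\<in>F. -1)"
      by (intro prod.cong) (auto simp: heaviside_def)
    then show ?thesis using True by simp
  next
    case False
    then obtain j where "j \<in> F" "j \<notin> ?N" by blast
    then have "(\<Prod>j\<in>F. (heaviside (f j x) - 1)) = 0"
      by (intro prod_zero bexI[of _ j]) (auto simp: heaviside_def)
    then show ?thesis using False by simp
  qed
  then have "(\<Sum>F\<in>K. \<Prod>j\<in>F. (heaviside (f j x) - 1)) = (\<Sum>F\<in>K. if F \<subseteq> ?N then (-1) ^ card F else 0)"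
    by simp
  also have "\<dots> = (\<Sum>F\<in>Pow ?N. if F \<union> {} \<in> K then (-1) ^ card F else 0)"
    by (simp add: sum.If_cases sum.inter_restrict[symmetric] Pow_def Int_def conj_commute)
  also have "\<dots> = (\<Prod>j\<in>UNIV. heaviside (f j x))"
  proof (cases "?N = {}")
    case True
    then have "(\<Prod>j\<in>UNIV. heaviside (f j x)) = 1" by (auto simp: heaviside_def not_less)
    then show ?thesis unfolding True using \<open>{} \<in> K\<close> by simp
  next
    case False
    then obtain j where "f j x < 0" by blast
    then have "(\<Prod>j\<in>UNIV. heaviside (f j x)) = 0"
      by (intro prod_zero bexI[of _ j]) (auto simp: heaviside_def)
    then show ?thesis
      using visible_faces_alternating_sum[OF aff strict active \<open>{} \<in> K\<close> _ False] by auto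
  qed
  finally show ?thesis .
qed

subsection \<open>Stability of the face complex\<close>

lemma lin_fun_inner: "lin_fun a b j x = column j a \<bullet> x + b $ j"
  by (simp add: lin_fun_def column_def inner_vec_def)

text \<open>Coefficients are indexed by \<open>A\<close> instead of the image set, so that repeated
  vectors are allowed, as in \<open>lin_indep_family\<close>.\<close>

lemma span_image_eq_sum:
  fixes g :: "'i \<Rightarrow> 'a::real_vector"
  assumes "finite A" "x \<in> span (g ` A)"
  shows "\<exists>c. x = (\<Sum>i\<in>A. c i *\<^sub>R g i)"
proof -
  let ?S = "{x. \<exists>c. x = (\<Sum>i\<in>A. c i *\<^sub>R g i)}"
  have "subspace ?S"
  proof (rule subspaceI)
    show "0 \<in> ?S" by (auto intro!: exI[of _ "\<lambda>_. 0"])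
    show "x + y \<in> ?S" if "x \<in> ?S" "y \<in> ?S" for x y
    proof -
      from that obtain c d where "x = (\<Sum>i\<in>A. c i *\<^sub>R g i)" "y = (\<Sum>i\<in>A. d i *\<^sub>R g i)" by blast
      then have "x + y = (\<Sum>i\<in>A. (c i + d i) *\<^sub>R g i)" by (simp add: sum.distrib scaleR_add_left)
      then show ?thesis by (intro CollectI exI)
    qed
    show "r *\<^sub>R x \<in> ?S" if "x \<in> ?S" for r x
    proof -
      from that obtain c where "x = (\<Sum>i\<in>A. c i *\<^sub>R g i)" by blast
      then have "r *\<^sub>R x = (\<Sum>i\<in>A. (r * c i) *\<^sub>R g i)" by (simp add: scaleR_sum_right)
      then show ?thesis by (intro CollectI exI)
    qed
  qed
  moreover have "g ` A \<subseteq> ?S"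
  proof clarify
    fix i assume "i \<in> A"
    then have "g i = (\<Sum>k\<in>A. (if k = i then 1 else 0) *\<^sub>R g k)"
      using assms(1) by (simp add: if_distrib[of "\<lambda>r. r *\<^sub>R _"] cong: if_cong)
    then show "\<exists>c. g i = (\<Sum>k\<in>A. c k *\<^sub>R g k)"
      by (rule exI[of _ "\<lambda>k. if k = i then 1 else 0"])
  qed
  ultimately have "span (g ` A) \<subseteq> ?S" by (rule span_minimal[rotated])
  then show ?thesis using assms(2) by blast
qed

text \<open>The component \<open>q\<close> of \<open>g j\<close> orthogonal to the other vectors is
  nonzero by independence, and \<open>q\<close> divided by \<open>q \<bullet> q\<close> is the dual
  vector.\<close>

lemma dual_vector_exists:
  fixes g :: "'i \<Rightarrow> 'a::euclidean_space"
  assumes "finite A" "j \<in> A" "lin_indep_family A (\<lambda>j z. g j \<bullet> z)"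
  shows "\<exists>v. \<forall>k\<in>A. g k \<bullet> v = (if k = j then 1 else 0)"
proof -
  obtain p q where pq: "p \<in> span (g ` (A - {j}))" "\<And>w. w \<in> span (g ` (A - {j})) \<Longrightarrow> orthogonal q w"
      "g j = p + q"
    using orthogonal_subspace_decomp_exists[of "g ` (A - {j})" "g j"] by blast
  have "q \<noteq> 0"
  proof
    assume "q = 0"
    then obtain c where c: "g j = (\<Sum>k\<in>A - {j}. c k *\<^sub>R g k)"
      using span_image_eq_sum[of "A - {j}" p g] pq assms(1) by auto
    \<comment> \<open>Writing \<open>g j\<close> through the other vectors gives a relation with
      coefficient -1 at \<open>j\<close>, against independence.\<close>
    have "(\<Sum>k\<in>A. (if k = j then - 1 else c k) * (g k \<bullet> z)) = 0" for z
    proof -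
      have "(\<Sum>k\<in>A. (if k = j then - 1 else c k) * (g k \<bullet> z)) =
          - (g j \<bullet> z) + (\<Sum>k\<in>A - {j}. (if k = j then - 1 else c k) * (g k \<bullet> z))"
        using assms(1,2) by (subst sum.remove[of _ j]) auto
      also have "(\<Sum>k\<in>A - {j}. (if k = j then - 1 else c k) * (g k \<bullet> z)) = g j \<bullet> z"
        unfolding c inner_sum_left by (intro sum.cong) auto
      finally show ?thesis by simp
    qed
    then show False
      using assms(2,3) unfolding lin_indep_family_def
      by (auto dest!: spec[of _ "\<lambda>k. if k = j then - 1 else c k"])
  qed
  then have qq: "q \<bullet> q > 0" by simp
  have "g k \<bullet> ((1 / (q \<bullet> q)) *\<^sub>R q) = (if k = j then 1 else 0)" if "k \<in> A" for k
  proof (cases "k = j")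
    case True
    have "p \<bullet> q = 0" using pq(2)[OF pq(1)] by (simp add: orthogonal_def inner_commute)
    then show ?thesis using True qq by (simp add: pq(3) inner_add_left)
  next
    case False
    then have "orthogonal q (g k)" using that by (intro pq(2) span_base) auto
    then show ?thesis using False by (simp add: orthogonal_def inner_commute)
  qed
  then show ?thesis by blast
qed

section \<open>Homogenized forms and general position\<close>

fun hom_vec :: "real^'n^'d \<Rightarrow> real^'n \<Rightarrow> 'n option \<Rightarrow> real \<times> (real^'d)" where
  "hom_vec a b None = (1, 0)"
| "hom_vec a b (Some j) = (b $ j, column j a)"

lemma hom_form_inner: "hom_form a b j z = hom_vec a b j \<bullet> z"
  by (cases j; cases z) (auto simp: column_def inner_vec_def)

text \<open>General position makes the forms vanishing at \<open>z\<close> independent, and form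
  \<open>j\<close> is one of them, so a dual vector exists for it.\<close>

lemma general_position_dual:
  assumes "general_position a b" "z \<in> hom_cone a b" "z \<noteq> 0" "hom_form a b j z = 0"
  shows "\<exists>v. \<forall>k. hom_form a b k z = 0 \<longrightarrow> hom_form a b k v = (if k = j then 1 else 0)"
proof -
  have "\<exists>y\<in>hom_cone a b. y \<noteq> 0 \<and> (\<forall>j\<in>{k. hom_form a b k z = 0}. hom_form a b j y = 0)"
    by (rule bexI[of _ z]) (simp_all add: assms(2,3))
  then have "lin_indep_family {k. hom_form a b k z = 0} (hom_form a b)"
    by (rule assms(1)[unfolded general_position_def, THEN spec, THEN mp])
  then have "lin_indep_family {k. hom_form a b k z = 0} (\<lambda>k z. hom_vec a b k \<bullet> z)"
    unfolding hom_form_inner[abs_def] .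
  then have "\<exists>v. \<forall>k\<in>{k. hom_form a b k z = 0}. hom_vec a b k \<bullet> v = (if k = j then 1 else 0)"
    using assms(4) by (intro dual_vector_exists) auto
  then show ?thesis unfolding hom_form_inner by blast
qed

text \<open>Move \<open>z\<close> slightly along the sum \<open>w\<close> of the dual vectors of
  those active forms that are not in \<open>L\<close>. These forms become positive, the forms in
  \<open>L\<close> stay zero, and the inactive ones stay positive for a small step.\<close>

lemma general_position_strict:
  assumes "general_position a b" "z \<in> hom_cone a b" "z \<noteq> 0" "\<forall>j\<in>L. hom_form a b j z = 0"
  shows "\<exists>z'. (\<forall>j\<in>L. hom_form a b j z' = 0) \<and> (\<forall>j. j \<notin> L \<longrightarrow> hom_form a b j z' > 0)"
proof -
  define A where "A = {j. hom_form a b j z = 0}"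
  have LA: "L \<subseteq> A" using assms(4) by (auto simp: A_def)
  have "\<forall>j\<in>A. \<exists>v. \<forall>k\<in>A. hom_form a b k v = (if k = j then 1 else 0)"
    using general_position_dual[OF assms(1-3)] by (auto simp: A_def)
  then obtain v where v: "\<And>j k. j \<in> A \<Longrightarrow> k \<in> A \<Longrightarrow> hom_form a b k (v j) = (if k = j then 1 else 0)"
    by metis
  define w where "w = (\<Sum>j\<in>A - L. v j)"
  have w: "hom_form a b k w = (if k \<in> L then 0 else 1)" if "k \<in> A" for k
  proof -
    have "hom_form a b k w = (\<Sum>j\<in>A - L. if k = j then 1 else 0)"
      unfolding w_def hom_form_inner inner_sum_right using v[OF _ that]
      by (intro sum.cong) (auto simp: hom_form_inner)
    then show ?thesis using that by simp
  qed
  have lin: "hom_form a b k (z + e *\<^sub>R w) = hom_form a b k z + e * hom_form a b k w" for k e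
    by (simp add: hom_form_inner inner_add_right)
  have "\<forall>k\<in>- A. eventually (\<lambda>e. hom_form a b k (z + e *\<^sub>R w) > 0) (at_right 0)"
  proof
    fix k assume "k \<in> - A"
    then have "hom_form a b k z > 0"
      using assms(2) by (auto simp: A_def hom_cone_def less_le)
    moreover have "((\<lambda>e. hom_form a b k (z + e *\<^sub>R w)) \<longlongrightarrow> hom_form a b k z + 0 * hom_form a b k w) (at_right 0)"
      unfolding lin by (intro tendsto_intros)
    ultimately show "eventually (\<lambda>e. hom_form a b k (z + e *\<^sub>R w) > 0) (at_right 0)"
      by (intro order_tendstoD) auto
  qed
  then have "eventually (\<lambda>e. \<forall>k\<in>- A. hom_form a b k (z + e *\<^sub>R w) > 0) (at_right (0::real))"
    by (simp add: eventually_ball_finite)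
  then have "eventually (\<lambda>e. e > 0 \<and> (\<forall>k\<in>- A. hom_form a b k (z + e *\<^sub>R w) > 0)) (at_right (0::real))"
    using eventually_at_right_less by (rule eventually_conj[rotated])
  then obtain e :: real where e: "e > 0" "\<forall>k\<in>- A. hom_form a b k (z + e *\<^sub>R w) > 0"
    by (metis (no_types, lifting) eventually_happens' trivial_limit_at_right_real)
  have "hom_form a b k (z + e *\<^sub>R w) = 0" if "k \<in> L" for k
    using that LA w[of k] by (auto simp: lin A_def)
  moreover have "hom_form a b k (z + e *\<^sub>R w) > 0" if "k \<notin> L" for k
    using e that w[of k] by (cases "k \<in> A") (auto simp: lin A_def)
  ultimately show ?thesis by blast
qed

definition on_face :: "real^'n^'d \<Rightarrow> real^'n \<Rightarrow> 'n set \<Rightarrow> real^'d \<Rightarrow> bool" where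
  "on_face a b L x \<longleftrightarrow> (\<forall>j. lin_fun a b j x \<ge> 0) \<and> (\<forall>j\<in>L. lin_fun a b j x = 0)"

definition rel_interior_face :: "real^'n^'d \<Rightarrow> real^'n \<Rightarrow> 'n set \<Rightarrow> real^'d \<Rightarrow> bool" where
  "rel_interior_face a b L x \<longleftrightarrow> (\<forall>j\<in>L. lin_fun a b j x = 0) \<and> (\<forall>j. j \<notin> L \<longrightarrow> lin_fun a b j x > 0)"

text \<open>Nonemptiness enters for \<open>L = {}\<close>: the empty intersection is the whole
  space, whereas \<open>on_face\<close> still asks for a point of the polyhedron.\<close>

lemma simp_complex_iff:
  assumes "P_set a b \<noteq> {}"
  shows "L \<in> simp_complex a b \<longleftrightarrow> (\<exists>x. on_face a b L x)"
proof (cases "L = {}")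
  case True
  then show ?thesis using assms
    by (auto simp: simp_complex_def on_face_def P_set_def half_space_def)
next
  case False
  have mem: "x \<in> F_set a b j \<longleftrightarrow> (\<forall>i. lin_fun a b i x \<ge> 0) \<and> lin_fun a b j x = 0" for x j
    by (simp add: F_set_def P_set_def half_space_def)
  have *: "x \<in> (\<Inter>j\<in>L. F_set a b j) \<longleftrightarrow> on_face a b L x" for x
    unfolding INT_iff mem on_face_def using False by blast
  show ?thesis unfolding *[symmetric] simp_complex_def mem_Collect_eq ex_in_conv ..
qed

lemma hom_form_Some: "hom_form a b (Some j) (1, x) = lin_fun a b j x"
  by (simp add: lin_fun_def)

lemma hom_form_scale: "hom_form a b j (c *\<^sub>R z) = c * hom_form a b j z"
  by (simp add: hom_form_inner)

text \<open>The index \<open>None\<close> is outside the image of \<open>L\<close> under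
  \<open>Some\<close>, so the strict version makes the homogenizing coordinate positive too. Thus
  even a point \<open>z\<close> at infinity yields, after division by that coordinate, an ordinary
  point of the face.\<close>

lemma homogenized_face:
  assumes "general_position a b" "z \<in> hom_cone a b" "z \<noteq> 0" "\<forall>j\<in>L. hom_form a b (Some j) z = 0"
  shows "\<exists>x. rel_interior_face a b L x"
proof -
  obtain z' where z': "\<forall>j\<in>Some ` L. hom_form a b j z' = 0" "\<forall>j. j \<notin> Some ` L \<longrightarrow> hom_form a b j z' > 0"
    using general_position_strict[OF assms(1-3), of "Some ` L"] assms(4) by blast
  obtain t x where tx: "z' = (t, x)" by (cases z')
  have t: "t > 0" using z'(2)[rule_format, of None] by (auto simp: tx)
  have "z' = t *\<^sub>R (1, (1 / t) *\<^sub>R x)" using t by (simp add: tx)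
  then have eq: "hom_form a b (Some j) z' = t * lin_fun a b j ((1 / t) *\<^sub>R x)" for j
    by (metis hom_form_Some hom_form_scale)
  have "rel_interior_face a b L ((1 / t) *\<^sub>R x)"
    unfolding rel_interior_face_def
  proof (intro conjI ballI allI impI)
    fix j
    show "lin_fun a b j ((1 / t) *\<^sub>R x) = 0" if "j \<in> L"
      using z'(1) that eq[of j] t by auto
    show "lin_fun a b j ((1 / t) *\<^sub>R x) > 0" if "j \<notin> L"
      using z'(2)[rule_format, of "Some j"] that eq[of j] t by (auto simp: zero_less_mult_iff)
  qed
  then show ?thesis ..
qed

lemma on_face_hom_cone:
  assumes "on_face a b L x"
  shows "(1, x) \<in> hom_cone a b" "\<forall>j\<in>L. hom_form a b (Some j) (1, x) = 0"
proof -
  show "\<forall>j\<in>L. hom_form a b (Some j) (1, x) = 0"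
    using assms unfolding hom_form_Some on_face_def by blast
  have "hom_form a b j (1, x) \<ge> 0" for j
  proof (cases j)
    case (Some i)
    then show ?thesis using assms unfolding Some hom_form_Some on_face_def by blast
  qed simp
  then show "(1, x) \<in> hom_cone a b" by (simp add: hom_cone_def)
qed

section \<open>Persistence of faces and of non-faces\<close>

lemma tendsto_det:
  fixes M :: "'a \<Rightarrow> real^'n^'n"
  assumes "\<And>i j. ((\<lambda>x. M x $ i $ j) \<longlongrightarrow> N $ i $ j) F"
  shows "((\<lambda>x. det (M x)) \<longlongrightarrow> det N) F"
  unfolding det_def by (intro tendsto_intros assms)

lemma lin_fun_tendsto:
  assumes "(A \<longlongrightarrow> a) F" "(B \<longlongrightarrow> b) F" "(X \<longlongrightarrow> x) F"
  shows "((\<lambda>p. lin_fun (A p) (B p) j (X p)) \<longlongrightarrow> lin_fun a b j x) F"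
  unfolding lin_fun_def by (intro tendsto_intros assms)

text \<open>Start from a relative interior point \<open>y0\<close> at the base parameter and correct
  it along vectors dual to the normals in \<open>L\<close>. The corrections solve a linear system
  close to the identity, so they tend to 0 and the strict inequalities outside \<open>L\<close>
  survive.\<close>

lemma eventually_face:
  fixes a0 :: "real^'n^'d" and b0 :: "real^'n"
  assumes gp: "general_position a0 b0" and "on_face a0 b0 L x0"
  shows "eventually (\<lambda>(a, b). (\<exists>y. rel_interior_face a b L y) \<and>
    (\<forall>j\<in>L. \<exists>v. \<forall>k\<in>L. column k a \<bullet> v = (if k = j then 1 else 0))) (nhds (a0, b0))"
proof -
  obtain y0 where y0: "rel_interior_face a0 b0 L y0"
    using homogenized_face[OF gp on_face_hom_cone(1)[OF assms(2)] _ on_face_hom_cone(2)[OF assms(2)]]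
    by (auto simp: zero_prod_def)
  have of: "on_face a0 b0 L y0"
    using y0 unfolding on_face_def rel_interior_face_def by (metis less_eq_real_def)
  have "\<forall>j\<in>L. \<exists>w. \<forall>k\<in>L. column k a0 \<bullet> w = (if k = j then 1 else 0)"
  proof
    fix j assume j: "j \<in> L"
    obtain v where v: "\<forall>k. hom_form a0 b0 k (1, y0) = 0 \<longrightarrow> hom_form a0 b0 k v = (if k = Some j then 1 else 0)"
      using general_position_dual[OF gp on_face_hom_cone(1)[OF of], of "Some j"]
        on_face_hom_cone(2)[OF of] j by (auto simp: zero_prod_def simp del: hom_form.simps)
    \<comment> \<open>Subtracting \<open>fst v\<close> times \<open>(1, y0)\<close>, where all forms
      in \<open>L\<close> vanish, makes the homogenizing coordinate of the dual vector zero without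
      changing its values on \<open>L\<close>.\<close>
    have "column k a0 \<bullet> (snd v - fst v *\<^sub>R y0) = (if k = j then 1 else 0)" if "k \<in> L" for k
    proof -
      have 1: "column k a0 \<bullet> y0 + b0 $ k = 0"
        using of that by (auto simp: on_face_def lin_fun_inner)
      have "hom_form a0 b0 (Some k) v = (if k = j then 1 else 0)"
        using v[rule_format, of "Some k"] on_face_hom_cone(2)[OF of] that by simp
      then have "b0 $ k * fst v + column k a0 \<bullet> snd v = (if k = j then 1 else 0)"
        by (cases v) (simp add: hom_form_inner)
      moreover have "column k a0 \<bullet> y0 = - b0 $ k" using 1 by simp
      ultimately show ?thesis by (simp add: inner_diff_right algebra_simps)
    qed
    then show "\<exists>w. \<forall>k\<in>L. column k a0 \<bullet> w = (if k = j then 1 else 0)" by blast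
  qed
  then obtain w where w: "\<And>j k. j \<in> L \<Longrightarrow> k \<in> L \<Longrightarrow> column k a0 \<bullet> w j = (if k = j then 1 else 0)"
    by metis
  \<comment> \<open>Padding with the identity outside \<open>L\<close> gives a square matrix over
    the whole index type, as \<open>det\<close> and \<open>cramer\<close> require.\<close>
  define M :: "real^'n^'d \<Rightarrow> real^'n^'n" where
    "M a = (\<chi> k j. if k \<in> L \<and> j \<in> L then column k a \<bullet> w j else if k = j then 1 else 0)" for a
  have M0: "M a0 = mat 1" using w by (auto simp: M_def mat_def vec_eq_iff)
  \<comment> \<open>\<open>r\<close> is the residual of \<open>y0\<close> at the perturbed
    parameter. \<open>c\<close> cancels it, and is written out by Cramer's rule so that its limit
    can be read off.\<close>
  define r where "r a b = (\<chi> k. if k \<in> L then - lin_fun a b k y0 else 0)" for a b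
  have r0: "r a0 b0 = 0" using y0 by (auto simp: r_def rel_interior_face_def vec_eq_iff)
  define c where "c a b = (\<chi> k. det (\<chi> i j. if j = k then r a b $ i else M a $ i $ j) / det (M a))" for a b
  define y where "y a b = y0 + (\<Sum>j\<in>L. c a b $ j *\<^sub>R w j)" for a b
  have solve: "(\<Sum>j\<in>L. s $ j * (column k a \<bullet> w j)) = (M a *v s) $ k" if "k \<in> L" for a k s
  proof -
    have "(M a *v s) $ k = (\<Sum>j\<in>UNIV. if j \<in> L then s $ j * (column k a \<bullet> w j) else 0)"
      unfolding matrix_vector_mult_def M_def using that by (auto intro!: sum.cong)
    then show ?thesis by (simp add: sum.If_cases)
  qed
  let ?F = "nhds (a0, b0)"
  have A: "(fst \<longlongrightarrow> a0) ?F" and B: "(snd \<longlongrightarrow> b0) ?F"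
    using tendsto_fst[of "\<lambda>p. p" "(a0, b0)" ?F] tendsto_snd[of "\<lambda>p. p" "(a0, b0)" ?F]
    by (simp_all add: filterlim_ident)
  have Mlim: "((\<lambda>p. M (fst p) $ i $ j) \<longlongrightarrow> M a0 $ i $ j) ?F" for i j
    unfolding M_def column_def using A by (auto intro!: tendsto_intros)
  have detM: "((\<lambda>p. det (M (fst p))) \<longlongrightarrow> 1) ?F"
    using tendsto_det[of "\<lambda>p. M (fst p)" "M a0" ?F] Mlim by (simp add: M0)
  have rlim: "((\<lambda>p. r (fst p) (snd p) $ i) \<longlongrightarrow> r a0 b0 $ i) ?F" for i
    unfolding r_def using lin_fun_tendsto[OF A B tendsto_const] by (auto intro!: tendsto_intros)
  have "((\<lambda>p. det (\<chi> i j. if j = k then r (fst p) (snd p) $ i else M (fst p) $ i $ j)) \<longlongrightarrow>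
      det (\<chi> i j. if j = k then r a0 b0 $ i else M a0 $ i $ j)) ?F" for k
    by (intro tendsto_det) (use Mlim rlim in auto)
  from tendsto_divide[OF this detM] have "((\<lambda>p. c (fst p) (snd p) $ k) \<longlongrightarrow> c a0 b0 $ k) ?F" for k
    by (simp add: c_def M0)
  moreover have "c a0 b0 = 0"
    using cramer[of "M a0" 0 "r a0 b0"] unfolding c_def by (simp add: M0 r0)
  ultimately have clim: "((\<lambda>p. c (fst p) (snd p) $ k) \<longlongrightarrow> 0) ?F" for k by simp
  have "((\<lambda>p. y (fst p) (snd p)) \<longlongrightarrow> y0 + (\<Sum>j\<in>L. 0 *\<^sub>R w j)) ?F"
    unfolding y_def by (intro tendsto_intros clim)
  then have ylim: "((\<lambda>p. y (fst p) (snd p)) \<longlongrightarrow> y0) ?F" by simp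
  have "\<forall>k\<in>- L. eventually (\<lambda>p. lin_fun (fst p) (snd p) k (y (fst p) (snd p)) > 0) ?F"
    using y0 by (auto simp: rel_interior_face_def intro!: order_tendstoD(1)[OF lin_fun_tendsto[OF A B ylim]])
  then have 1: "eventually (\<lambda>p. \<forall>k\<in>- L. lin_fun (fst p) (snd p) k (y (fst p) (snd p)) > 0) ?F"
    by (simp add: eventually_ball_finite)
  have 2: "eventually (\<lambda>p. det (M (fst p)) \<noteq> 0) ?F"
    using detM by (rule tendsto_imp_eventually_ne) simp
  show ?thesis
    using eventually_conj[OF 1 2]
  proof (rule eventually_mono)
    fix p assume p: "(\<forall>k\<in>- L. lin_fun (fst p) (snd p) k (y (fst p) (snd p)) > 0) \<and> det (M (fst p)) \<noteq> 0"
    obtain a b where ab: "p = (a, b)" by (cases p)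
    have pos: "\<forall>k\<in>- L. 0 < lin_fun a b k (y a b)" and det: "det (M a) \<noteq> 0"
      using p by (simp_all add: ab)
    have Mc: "M a *v c a b = r a b" using cramer[OF det] unfolding c_def by blast
    have "lin_fun a b k (y a b) = 0" if "k \<in> L" for k
    proof -
      have "lin_fun a b k (y a b) = lin_fun a b k y0 + (M a *v c a b) $ k"
        unfolding solve[OF that, symmetric] by (simp add: lin_fun_inner y_def inner_add_right inner_sum_right)
      then show ?thesis using that by (simp add: Mc r_def)
    qed
    then have "rel_interior_face a b L (y a b)" using pos by (auto simp: rel_interior_face_def)
    \<comment> \<open>The perturbed dual vector combines the old ones, with coefficients solving the
      same system for a unit vector on the right.\<close>
    moreover have "\<exists>v. \<forall>k\<in>L. column k a \<bullet> v = (if k = j then 1 else 0)" if "j \<in> L" for j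
    proof -
      obtain s where s: "M a *v s = axis j 1" using cramer[OF det] by blast
      have "column k a \<bullet> (\<Sum>i\<in>L. s $ i *\<^sub>R w i) = (if k = j then 1 else 0)" if "k \<in> L" for k
        using solve[OF that, where s = s and a = a]
        by (simp add: inner_sum_right s axis_def)
      then show ?thesis by blast
    qed
    ultimately show "case p of (a, b) \<Rightarrow> (\<exists>y. rel_interior_face a b L y) \<and>
        (\<forall>j\<in>L. \<exists>v. \<forall>k\<in>L. column k a \<bullet> v = (if k = j then 1 else 0))"
      unfolding ab prod.case by blast
  qed
qed

text \<open>The conditions on cone point and parameter are closed, and projecting along the compact
  unit sphere keeps them closed. The base parameter is outside the projection: by
  \<open>homogenized_face\<close> any solution on the sphere, even one at infinity, would give a
  genuine point of the face.\<close>

lemma eventually_not_face: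
  fixes a0 :: "real^'n^'d" and b0 :: "real^'n"
  assumes gp: "general_position a0 b0" and nf: "\<nexists>x. on_face a0 b0 L x"
  shows "eventually (\<lambda>(a, b). \<nexists>x. on_face a b L x) (nhds (a0, b0))"
proof -
  define T where "T = {(z :: real \<times> (real^'d), p :: (real^'n^'d) \<times> (real^'n)).
      (\<forall>j. hom_form (fst p) (snd p) j z \<ge> 0) \<and> (\<forall>j\<in>L. hom_form (fst p) (snd p) (Some j) z = 0)}"
  have cont: "continuous_on UNIV
      (\<lambda>q :: (real \<times> (real^'d)) \<times> (real^'n^'d) \<times> (real^'n). hom_form (fst (snd q)) (snd (snd q)) j (fst q))" for j
  proof (cases j)
    case None
    then show ?thesis unfolding hom_form_inner by (simp, intro continuous_intros)
  next
    case (Some i)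
    then show ?thesis unfolding hom_form_inner
      by (simp add: column_def inner_prod_def inner_vec_def, intro continuous_intros)
  qed
  have "T = (\<Inter>j. {q. hom_form (fst (snd q)) (snd (snd q)) j (fst q) \<ge> 0}) \<inter>
      (\<Inter>j\<in>L. {q. hom_form (fst (snd q)) (snd (snd q)) (Some j) (fst q) = 0})"
    by (simp add: T_def case_prod_unfold set_eq_iff)
  then have "closed T"
    by (simp only:) (intro closed_Int closed_INT ballI closed_Collect_le closed_Collect_eq continuous_on_const cont)
  then have "closed {p. \<exists>z. z \<in> sphere 0 1 \<and> (z, p) \<in> T}"
    by (intro closed_compact_projection) auto
  then have "open (- {p. \<exists>z. z \<in> sphere 0 1 \<and> (z, p) \<in> T})" by (rule open_Compl)
  moreover have "(a0, b0) \<in> - {p. \<exists>z. z \<in> sphere 0 1 \<and> (z, p) \<in> T}"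
  proof (rule ComplI)
    assume "(a0, b0) \<in> {p. \<exists>z. z \<in> sphere 0 1 \<and> (z, p) \<in> T}"
    then obtain z where z: "z \<in> sphere 0 1" "(z, (a0, b0)) \<in> T" by blast
    have "z \<noteq> 0" using z(1) by (auto simp del: zero_prod_def)
    moreover have "z \<in> hom_cone a0 b0" "\<forall>j\<in>L. hom_form a0 b0 (Some j) z = 0"
      using z(2) unfolding T_def hom_cone_def by auto
    ultimately obtain x where "rel_interior_face a0 b0 L x"
      using homogenized_face[OF gp] by blast
    then have "on_face a0 b0 L x"
      unfolding on_face_def rel_interior_face_def by (metis less_eq_real_def)
    then show False using nf by blast
  qed
  ultimately have "eventually (\<lambda>p. p \<in> - {p. \<exists>z. z \<in> sphere 0 1 \<and> (z, p) \<in> T}) (nhds (a0, b0))"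
    by (rule eventually_nhds_in_open)
  then show ?thesis
  proof (rule eventually_mono)
    fix p assume p: "p \<in> - {p. \<exists>z. z \<in> sphere 0 1 \<and> (z, p) \<in> T}"
    obtain a b where ab: "p = (a, b)" by (cases p)
    have notin: "(a, b) \<in> - {p. \<exists>z. z \<in> sphere 0 1 \<and> (z, p) \<in> T}" using p unfolding ab .
    have False if x: "on_face a b L x" for x
    proof -
    \<comment> \<open>All conditions are homogeneous in the cone point, so \<open>(1, x)\<close> may
      be normalized to the sphere.\<close>
    define c where "c = 1 / norm (1 :: real, x)"
    have n: "norm (1 :: real, x) > 0" by (auto simp: zero_prod_def)
    then have c: "c > 0" by (simp add: c_def)
    have "c *\<^sub>R (1 :: real, x) \<in> sphere 0 1" unfolding mem_sphere_0 norm_scaleR c_def using n by simp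
    moreover have "(c *\<^sub>R (1 :: real, x), (a, b)) \<in> T"
      using on_face_hom_cone[OF x] unfolding T_def hom_cone_def
      by (auto simp only: hom_form_scale fst_conv snd_conv case_prod_conv mem_Collect_eq mult_eq_0_iff
          intro!: mult_nonneg_nonneg less_imp_le[OF c])
    ultimately show False using notin by blast
    qed
    then show "case p of (a, b) \<Rightarrow> \<nexists>x. on_face a b L x" unfolding ab prod.case by blast
  qed
qed

text \<open>Independence of the normals of a face is encoded by dual vectors, the form in which the
  differentiation uses it.\<close>

definition regular_at :: "'n set set \<Rightarrow> real^'n^'d \<Rightarrow> real^'n \<Rightarrow> bool" where
  "regular_at K a b \<longleftrightarrow>
    (\<forall>L x. on_face a b L x \<longrightarrow> L \<in> K) \<and>
    (\<forall>L\<in>K. (\<exists>y. rel_interior_face a b L y) \<and>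
      (\<forall>j\<in>L. \<exists>v. \<forall>k\<in>L. column k a \<bullet> v = (if k = j then 1 else 0)))"

lemma regular_neighbourhood:
  fixes a0 :: "real^'n^'d" and b0 :: "real^'n"
  assumes "general_position a0 b0" "P_set a0 b0 \<noteq> {}"
  shows "\<exists>U. open U \<and> (a0, b0) \<in> U \<and> (\<forall>(a, b)\<in>U. regular_at (simp_complex a0 b0) a b)"
proof -
  let ?K = "simp_complex a0 b0"
  let ?Q = "\<lambda>L a b. (L \<notin> ?K \<longrightarrow> (\<nexists>x. on_face a b L x)) \<and>
    (L \<in> ?K \<longrightarrow> (\<exists>y. rel_interior_face a b L y) \<and>
      (\<forall>j\<in>L. \<exists>v. \<forall>k\<in>L. column k a \<bullet> v = (if k = j then 1 else 0)))"
  have "eventually (\<lambda>p. ?Q L (fst p) (snd p)) (nhds (a0, b0))" for L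
  proof (cases "L \<in> ?K")
    case True
    then obtain x where "on_face a0 b0 L x" using simp_complex_iff[OF assms(2)] by blast
    from eventually_face[OF assms(1) this] show ?thesis
      by (rule eventually_mono) (use True in \<open>simp only: case_prod_unfold, blast\<close>)
  next
    case False
    then have "\<nexists>x. on_face a0 b0 L x" using simp_complex_iff[OF assms(2)] by blast
    from eventually_not_face[OF assms(1) this] show ?thesis
      by (rule eventually_mono) (use False in \<open>simp only: case_prod_unfold, blast\<close>)
  qed
  \<comment> \<open>Only finitely many index sets \<open>L\<close> exist, so their neighbourhoods
    can be intersected.\<close>
  then have "eventually (\<lambda>p. \<forall>L. ?Q L (fst p) (snd p)) (nhds (a0, b0))"
    by (rule eventually_all_finite)
  then obtain U where U: "open U" "(a0, b0) \<in> U" "\<forall>p\<in>U. \<forall>L. ?Q L (fst p) (snd p)"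
    unfolding eventually_nhds by blast
  have "regular_at ?K (fst p) (snd p)" if "p \<in> U" for p
    unfolding regular_at_def
  proof (intro conjI allI impI ballI)
    have Q: "?Q L (fst p) (snd p)" for L using U(3) that by blast
    show "L \<in> ?K" if "on_face (fst p) (snd p) L x" for L x using Q[of L] that by blast
    show "\<exists>y. rel_interior_face (fst p) (snd p) L y" if "L \<in> ?K" for L using Q[of L] that by blast
    show "\<exists>v. \<forall>k\<in>L. column k (fst p) \<bullet> v = (if k = j then 1 else 0)" if "L \<in> ?K" "j \<in> L" for L j
      using conjunct2[OF Q[of L]] that by blast
  qed
  then show ?thesis using U(1,2) by (intro exI[of _ U]) auto
qed

subsection \<open>Gram determinants\<close>

text \<open>The identity padding kills every permutation that moves a point outside
  \<open>S\<close>; this gives access to row operations for \<open>det\<close>.\<close>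

lemma det_on_eq_det:
  fixes M :: "'n::finite \<Rightarrow> 'n \<Rightarrow> real"
  shows "det_on S M = det (\<chi> i k. if i \<in> S \<and> k \<in> S then M i k else if i = k then 1 else 0)"
proof -
  let ?N = "\<chi> i k. if i \<in> S \<and> k \<in> S then M i k else if i = k then 1 else (0::real)"
  have "det ?N = (\<Sum>p | p permutes UNIV. of_int (sign p) * (\<Prod>i\<in>UNIV. ?N $ i $ p i))"
    by (simp add: det_def)
  also have "\<dots> = (\<Sum>p | p permutes S. of_int (sign p) * (\<Prod>i\<in>UNIV. ?N $ i $ p i))"
  proof (intro sum.mono_neutral_right ballI)
    show "{p. p permutes S} \<subseteq> {p. p permutes (UNIV :: 'n set)}"
      using permutes_subset by blast
    fix p assume p: "p \<in> {p. p permutes UNIV} - {p. p permutes S}"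
    then obtain i where "i \<notin> S" "p i \<noteq> i"
      using permutes_superset[of p UNIV S] by auto
    then have "(\<Prod>i\<in>UNIV. ?N $ i $ p i) = 0"
      by (intro prod_zero bexI[of _ i]) auto
    then show "of_int (sign p) * (\<Prod>i\<in>UNIV. ?N $ i $ p i) = 0" by simp
  qed (simp add: finite_permutations)
  also have "\<dots> = det_on S M"
    unfolding det_on_def
  proof (intro sum.cong refl)
    fix p assume p: "p \<in> {p. p permutes S}"
    then have "(\<Prod>i\<in>UNIV. ?N $ i $ p i) = (\<Prod>i\<in>S. ?N $ i $ p i)"
      by (intro prod.mono_neutral_right) (auto simp: permutes_def)
    also have "\<dots> = (\<Prod>i\<in>S. M i (p i))"
      using p by (intro prod.cong) (auto simp: permutes_in_image)
    finally show "of_int (sign p) * (\<Prod>i\<in>UNIV. ?N $ i $ p i) = of_int (sign p) * (\<Prod>i\<in>S. M i (p i))"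
      by simp
  qed
  finally show ?thesis ..
qed

text \<open>Row \<open>j\<close> vanishes off the diagonal, so only permutations fixing
  \<open>j\<close> contribute.\<close>

lemma det_on_insert:
  assumes "finite S" "j \<notin> S" "\<And>k. k \<in> S \<Longrightarrow> M j k = 0"
  shows "det_on (insert j S) M = M j j * det_on S M"
proof -
  have "det_on (insert j S) M = (\<Sum>p | p permutes S. of_int (sign p) * (\<Prod>i\<in>insert j S. M i (p i)))"
    unfolding det_on_def
  proof (intro sum.mono_neutral_right ballI)
    show "{p. p permutes S} \<subseteq> {p. p permutes insert j S}"
      using permutes_subset by blast
    fix p assume p: "p \<in> {p. p permutes insert j S} - {p. p permutes S}"
    then have "p j \<noteq> j" using permutes_superset[of p "insert j S" S] by auto
    moreover have "p j \<in> insert j S" using p permutes_in_image[of p "insert j S" j] by blast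
    ultimately have "M j (p j) = 0" using assms(3) by blast
    then have "(\<Prod>i\<in>insert j S. M i (p i)) = 0"
      using assms(1) by (intro prod_zero bexI[of _ j]) auto
    then show "of_int (sign p) * (\<Prod>i\<in>insert j S. M i (p i)) = 0" by simp
  qed (use assms(1) in \<open>simp add: finite_permutations\<close>)
  also have "\<dots> = (\<Sum>p | p permutes S. M j j * (of_int (sign p) * (\<Prod>i\<in>S. M i (p i))))"
    using assms(1,2) by (intro sum.cong refl) (auto simp: permutes_def)
  also have "\<dots> = M j j * det_on S M" by (simp add: det_on_def sum_distrib_left)
  finally show ?thesis .
qed

lemma det_on_cong:
  assumes "\<And>i k. i \<in> S \<Longrightarrow> k \<in> S \<Longrightarrow> M i k = N i k"
  shows "det_on S M = det_on S N"
  unfolding det_on_def using assms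
  by (intro sum.cong prod.cong arg_cong2[where f = times] refl) (auto simp: permutes_in_image)

lemma gram_inner: "gram a i k = column i a \<bullet> column k a"
  by (simp add: gram_def column_def inner_vec_def)

lemma det_on_gram_insert:
  fixes a :: "real^'n^'d"
  assumes "j \<notin> J" "column j a = p + q" "p \<in> span ((\<lambda>k. column k a) ` J)"
    and orth: "\<And>k. k \<in> J \<Longrightarrow> q \<bullet> column k a = 0"
  shows "det_on (insert j J) (gram a) = (q \<bullet> q) * det_on J (gram a)"
proof -
  obtain c where c: "p = (\<Sum>k\<in>J. c k *\<^sub>R column k a)"
    using span_image_eq_sum[OF _ assms(3)] by auto
  define M where "M i k = (if i = j then q \<bullet> column k a else gram a i k)" for i k
  let ?full = "\<lambda>M. \<chi> i k. if i \<in> insert j J \<and> k \<in> insert j J then M i k else if i = k then 1 else (0::real)"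
  \<comment> \<open>\<open>x\<close> restores the contribution of \<open>p\<close> to row
    \<open>j\<close>: its entries in \<open>insert j J\<close> are the products of \<open>p\<close>
    with the columns.\<close>
  define x where "x = (\<Sum>k\<in>J. c k *s row k (?full M))"
  have "x \<in> vec.span {row k (?full M) | k. k \<noteq> j}"
    unfolding x_def using assms(1) by (intro vec.span_sum vec.span_scale vec.span_base) auto
  then have "det (\<chi> k. if k = j then row j (?full M) + x else row k (?full M)) = det (?full M)"
    by (rule det_row_span)
  also have "(\<chi> k. if k = j then row j (?full M) + x else row k (?full M)) = ?full (gram a)"
  proof -
    have "(row j (?full M) + x) $ k = ?full (gram a) $ j $ k" for k
    proof (cases "k \<in> insert j J")
      case True
      then have "x $ k = (\<Sum>i\<in>J. c i * gram a i k)"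
        unfolding x_def using assms(1) by (auto simp: row_def M_def intro!: sum.cong)
      also have "\<dots> = p \<bullet> column k a" by (simp add: c gram_inner inner_sum_left)
      finally show ?thesis
        using True by (simp add: row_def M_def gram_inner assms(2) inner_add_left)
    next
      case False
      then have "x $ k = 0" unfolding x_def by (auto simp: row_def intro!: sum.neutral)
      then show ?thesis using False by (auto simp: row_def)
    qed
    then show ?thesis using assms(1) by (auto simp: vec_eq_iff row_def M_def)
  qed
  finally have "det_on (insert j J) (gram a) = det_on (insert j J) M"
    unfolding det_on_eq_det by simp
  also have "\<dots> = M j j * det_on J M"
    using assms(1) orth by (intro det_on_insert) (auto simp: M_def)
  also have "det_on J M = det_on J (gram a)"
    using assms(1) by (intro det_on_cong) (auto simp: M_def)
  also have "M j j = q \<bullet> q"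
  proof -
    have "q \<bullet> p = 0" unfolding c by (simp add: inner_sum_right orth)
    then show ?thesis by (simp add: M_def assms(2) inner_add_right)
  qed
  finally show ?thesis .
qed

subsection \<open>Volume measures of affine subspaces\<close>

text \<open>
  Uniqueness of Haar measure up to scaling, by evaluating the double integral of
  \<open>1\<^sub>A(x) 1\<^sub>E(x + y)\<close> in both orders. Orthogonal invariance of Lebesgue measure is only available in the
  library for well-ordered index types.
\<close>
lemma translation_invariant_measures_proportional:
  fixes M N :: "'a::euclidean_space measure"
  assumes M: "sigma_finite_measure M" and N: "sigma_finite_measure N"
    and sets[measurable_cong]: "sets M = sets borel" "sets N = sets borel"
    and supp: "AE x in M. x \<in> W" "AE x in N. x \<in> W"
    and neg: "\<And>w. w \<in> W \<Longrightarrow> - w \<in> W"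
    and invM: "\<And>g w. g \<in> borel_measurable borel \<Longrightarrow> w \<in> W \<Longrightarrow> (\<integral>\<^sup>+x. g (w + x) \<partial>M) = (\<integral>\<^sup>+x. g x \<partial>M)"
    and invN: "\<And>g w. g \<in> borel_measurable borel \<Longrightarrow> w \<in> W \<Longrightarrow> (\<integral>\<^sup>+x. g (w + x) \<partial>N) = (\<integral>\<^sup>+x. g x \<partial>N)"
    and A[measurable]: "A \<in> sets borel" and sym: "\<And>x. - x \<in> A \<longleftrightarrow> x \<in> A"
    and E[measurable]: "E \<in> sets borel"
  shows "emeasure M A * emeasure N E = emeasure M E * emeasure N A"
proof -
  interpret pair_sigma_finite M N using M N by (rule pair_sigma_finite.intro)
  have "emeasure M A * emeasure N E = (\<integral>\<^sup>+x. indicator A x * (\<integral>\<^sup>+y. indicator E y \<partial>N) \<partial>M)"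
    by (simp add: nn_integral_multc)
  also have "\<dots> = (\<integral>\<^sup>+x. (\<integral>\<^sup>+y. indicator A x * indicator E (x + y) \<partial>N) \<partial>M)"
    using supp(1)
  proof (intro nn_integral_cong_AE, eventually_elim)
    case (elim x)
    have "(\<integral>\<^sup>+y. indicator E (x + y) \<partial>N) = (\<integral>\<^sup>+y. indicator E y \<partial>N)"
      using elim by (intro invN) auto
    then show ?case by (simp add: nn_integral_cmult)
  qed
  also have "\<dots> = (\<integral>\<^sup>+y. (\<integral>\<^sup>+x. indicator A x * indicator E (x + y) \<partial>M) \<partial>N)"
    by (rule Fubini'[symmetric]) simp
  \<comment> \<open>Translating \<open>x\<close> by \<open>- y\<close> moves the shift from
    \<open>E\<close> to \<open>A\<close>; symmetry of \<open>A\<close> turns it into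
    \<open>- x + y\<close>, which after another exchange is a translation in
    \<open>y\<close>.\<close>
  also have "\<dots> = (\<integral>\<^sup>+y. (\<integral>\<^sup>+x. indicator A (- x + y) * indicator E x \<partial>M) \<partial>N)"
    using supp(2)
  proof (intro nn_integral_cong_AE, eventually_elim)
    case (elim y)
    have "(\<integral>\<^sup>+x. indicator A x * indicator E (x + y) \<partial>M) =
        (\<integral>\<^sup>+x. indicator A (- y + x) * indicator E (- y + x + y) \<partial>M)"
      by (rule invM[symmetric, of "\<lambda>x. indicator A x * indicator E (x + y)"])
        (use elim neg in simp_all)
    also have "(\<lambda>x. indicator A (- y + x) :: ennreal) = (\<lambda>x. indicator A (- x + y))"
    proof
      fix x
      show "indicator A (- y + x) = (indicator A (- x + y) :: ennreal)"
        using sym[of "- x + y"] by (simp add: indicator_def)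
    qed
    finally show ?case by simp
  qed
  also have "\<dots> = (\<integral>\<^sup>+x. (\<integral>\<^sup>+y. indicator A (- x + y) * indicator E x \<partial>N) \<partial>M)"
    by (rule Fubini') simp
  also have "\<dots> = (\<integral>\<^sup>+x. emeasure N A * indicator E x \<partial>M)"
    using supp(1)
  proof (intro nn_integral_cong_AE, eventually_elim)
    case (elim x)
    have "(\<integral>\<^sup>+y. indicator A (- x + y) \<partial>N) = (\<integral>\<^sup>+y. indicator A y \<partial>N)"
      using elim neg by (intro invN) auto
    then show ?case by (simp add: nn_integral_multc)
  qed
  also have "\<dots> = emeasure M E * emeasure N A"
    by (simp add: nn_integral_cmult) (rule mult.commute)
  finally show ?thesis .
qed

section \<open>Translation invariance and frame independence of the volume\<close>

lemma PiM_lborel_translate: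
  fixes B :: "'b set" and s :: "'b \<Rightarrow> real"
  assumes "finite B"
  shows "distr (Pi\<^sub>M B (\<lambda>_. lborel)) (Pi\<^sub>M B (\<lambda>_. lborel)) (\<lambda>t. \<lambda>u\<in>B. s u + t u) = Pi\<^sub>M B (\<lambda>_. lborel :: real measure)"
proof -
  interpret product_sigma_finite "\<lambda>_ :: 'b. lborel :: real measure" ..
  show ?thesis
  proof (rule PiM_eqI[OF assms])
    fix A :: "'b \<Rightarrow> real set" assume A: "\<And>i. i \<in> B \<Longrightarrow> A i \<in> sets lborel"
    have meas: "(\<lambda>t. \<lambda>u\<in>B. s u + t u) \<in> Pi\<^sub>M B (\<lambda>_. lborel) \<rightarrow>\<^sub>M Pi\<^sub>M B (\<lambda>_. lborel :: real measure)"
      by measurable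
    have "emeasure (distr (Pi\<^sub>M B (\<lambda>_. lborel)) (Pi\<^sub>M B (\<lambda>_. lborel)) (\<lambda>t. \<lambda>u\<in>B. s u + t u)) (Pi\<^sub>E B A)
        = emeasure (Pi\<^sub>M B (\<lambda>_. lborel)) ((\<lambda>t. \<lambda>u\<in>B. s u + t u) -` Pi\<^sub>E B A \<inter> space (Pi\<^sub>M B (\<lambda>_. lborel)))"
      using A assms meas by (intro emeasure_distr sets_PiM_I_finite) auto
    also have "(\<lambda>t. \<lambda>u\<in>B. s u + t u) -` Pi\<^sub>E B A \<inter> space (Pi\<^sub>M B (\<lambda>_. lborel :: real measure)) =
        Pi\<^sub>E B (\<lambda>u. (+) (s u) -` A u)"
      by (auto simp: space_PiM PiE_iff)
    also have "emeasure (Pi\<^sub>M B (\<lambda>_. lborel)) \<dots> = (\<Prod>u\<in>B. emeasure lborel ((+) (s u) -` A u))"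
    proof (intro emeasure_PiM assms)
      fix u assume "u \<in> B"
      then have "(+) (s u) -` A u \<inter> space lborel \<in> sets lborel"
        using A by (intro measurable_sets[of _ _ lborel]) auto
      then show "(+) (s u) -` A u \<in> sets lborel" by simp
    qed
    also have "\<dots> = (\<Prod>u\<in>B. emeasure lborel (A u))"
    proof (intro prod.cong refl)
      fix u assume "u \<in> B"
      then have "emeasure lborel ((+) (s u) -` A u) = emeasure (distr lborel borel ((+) (s u))) (A u)"
        using A by (subst emeasure_distr) auto
      then show "emeasure lborel ((+) (s u) -` A u) = emeasure lborel (A u)"
        by (simp add: lborel_distr_plus)
    qed
    finally show "emeasure (distr (Pi\<^sub>M B (\<lambda>_. lborel)) (Pi\<^sub>M B (\<lambda>_. lborel)) (\<lambda>t. \<lambda>u\<in>B. s u + t u)) (Pi\<^sub>E B A)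
        = (\<Prod>u\<in>B. emeasure lborel (A u))" .
  qed simp
qed

lemma frame_map_measurable[measurable]:
  fixes c :: "'a::euclidean_space"
  shows "(\<lambda>t. c + (\<Sum>u\<in>B. t u *\<^sub>R u)) \<in> borel_measurable (Pi\<^sub>M B (\<lambda>_. lborel :: real measure))"
proof -
  have "(\<lambda>t. t u) \<in> borel_measurable (Pi\<^sub>M B (\<lambda>_. lborel :: real measure))" if "u \<in> B" for u
    using measurable_component_singleton[OF that, of "\<lambda>_. lborel :: real measure"] by simp
  then show ?thesis
    by (intro borel_measurable_add borel_measurable_const borel_measurable_sum borel_measurable_scaleR) auto
qed

lemma sets_frame_volume[measurable_cong, simp]: "sets (frame_volume c B) = sets borel"
  by (simp add: frame_volume_def)

lemma space_frame_volume[simp]: "space (frame_volume c B) = UNIV"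
  by (simp add: frame_volume_def)

text \<open>The coordinates of \<open>w\<close> in the frame are absorbed by translation invariance
  of the product measure.\<close>

lemma frame_volume_translate:
  assumes "finite B" "w \<in> span B"
  shows "frame_volume (c + w) B = frame_volume c B"
proof -
  let ?M = "Pi\<^sub>M B (\<lambda>_. lborel :: real measure)"
  obtain s where s: "w = (\<Sum>u\<in>B. s u *\<^sub>R u)"
    using assms span_finite[of B] by auto
  have "frame_volume c B = distr (distr ?M ?M (\<lambda>t. \<lambda>u\<in>B. s u + t u)) borel (\<lambda>t. c + (\<Sum>u\<in>B. t u *\<^sub>R u))"
    unfolding frame_volume_def PiM_lborel_translate[OF assms(1)] ..
  also have "\<dots> = distr ?M borel (\<lambda>t. c + (\<Sum>u\<in>B. (s u + t u) *\<^sub>R u))"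
    by (subst distr_distr) (auto simp: comp_def intro!: arg_cong[where f = "distr _ _"])
  also have "\<dots> = frame_volume (c + w) B"
    unfolding frame_volume_def s by (simp add: scaleR_add_left sum.distrib add.assoc)
  finally show ?thesis ..
qed

lemma frame_volume_shift: "frame_volume c B = distr (frame_volume 0 B) borel ((+) c)"
  unfolding frame_volume_def by (subst distr_distr) (auto simp: comp_def)

lemma norm_orthonormal_sum:
  assumes "finite B" "pairwise orthogonal B" "\<forall>u\<in>B. norm u = 1"
  shows "(norm (\<Sum>u\<in>B. t u *\<^sub>R u))\<^sup>2 = (\<Sum>u\<in>B. (t u)\<^sup>2)"
proof -
  have "(norm (\<Sum>u\<in>B. t u *\<^sub>R u))\<^sup>2 = (\<Sum>u\<in>B. (norm (t u *\<^sub>R u))\<^sup>2)"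
    using assms by (intro norm_sum_Pythagorean) (auto simp: pairwise_def orthogonal_def)
  also have "\<dots> = (\<Sum>u\<in>B. (t u)\<^sup>2)" using assms by (intro sum.cong) auto
  finally show ?thesis .
qed

lemma orthonormal_frameD:
  assumes "orthonormal_frame V c B"
  shows "finite B" "independent B" "pairwise orthogonal B" "\<forall>u\<in>B. norm u = 1" "V = (\<lambda>y. c + y) ` span B"
proof -
  show *: "pairwise orthogonal B" "\<forall>u\<in>B. norm u = 1" "V = (\<lambda>y. c + y) ` span B"
    using assms by (auto simp: orthonormal_frame_def)
  then have "0 \<notin> B" by auto
  then show "independent B" using * by (intro pairwise_orthogonal_independent)
  then show "finite B" by (rule independent_imp_finite)
qed

text \<open>The frame map preserves norms, so the preimage is a coordinate ball. The value depends
  only on \<open>card B\<close>, which is what normalizes the measures of different frames.\<close>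

lemma emeasure_frame_volume_cball:
  assumes "orthonormal_frame V c B" "r > 0"
  shows "emeasure (frame_volume 0 B) (cball 0 r) = ennreal (unit_ball_vol (real (card B)) * r ^ card B)"
proof -
  note B = orthonormal_frameD[OF assms(1)]
  have "norm (\<Sum>u\<in>B. t u *\<^sub>R u) = sqrt (\<Sum>u\<in>B. (t u)\<^sup>2)" for t
    using norm_orthonormal_sum[OF B(1,3,4), of t] by (metis norm_ge_zero real_sqrt_unique)
  then have "emeasure (frame_volume 0 B) (cball 0 r) = emeasure (Pi\<^sub>M B (\<lambda>_. lborel))
      ({t. sqrt (\<Sum>u\<in>B. (t u)\<^sup>2) \<le> r} \<inter> space (Pi\<^sub>M B (\<lambda>_. lborel :: real measure)))"
    unfolding frame_volume_def by (subst emeasure_distr) (auto simp: vimage_def)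
  then show ?thesis using emeasure_cball_aux[OF B(1) assms(2)] by simp
qed

lemma sigma_finite_frame_volume:
  assumes "orthonormal_frame V c B"
  shows "sigma_finite_measure (frame_volume 0 B)"
proof
  have "x \<in> (\<Union>n. cball 0 (real (Suc n)))" for x :: 'a
  proof -
    obtain n where "norm x \<le> real n" using real_arch_simple by blast
    then show ?thesis by (intro UN_I[of n]) auto
  qed
  then have "(\<Union>n. cball 0 (real (Suc n))) = (UNIV :: 'a set)" by blast
  then show "\<exists>A. countable A \<and> A \<subseteq> sets (frame_volume 0 B) \<and> \<Union> A = space (frame_volume 0 B) \<and>
      (\<forall>a\<in>A. emeasure (frame_volume 0 B) a \<noteq> \<infinity>)"
    by (intro exI[of _ "range (\<lambda>n. cball 0 (real (Suc n)))"])
      (auto simp del: of_nat_Suc simp: emeasure_frame_volume_cball[OF assms])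
qed

lemma AE_frame_volume:
  assumes "finite B"
  shows "AE x in frame_volume 0 B. x \<in> span B"
proof -
  have "(\<Sum>u\<in>B. t u *\<^sub>R u) \<in> span B" for t by (intro span_sum span_scale span_base)
  moreover have "{x. x \<in> span B} \<in> sets borel" using closed_span[of B] by (auto intro: borel_closed)
  ultimately show ?thesis unfolding frame_volume_def by (subst AE_distr_iff) auto
qed

lemma nn_integral_frame_volume_translate:
  assumes "finite B" "w \<in> span B" "g \<in> borel_measurable borel"
  shows "(\<integral>\<^sup>+x. g (w + x) \<partial>frame_volume 0 B) = (\<integral>\<^sup>+x. g x \<partial>frame_volume 0 B)"
proof -
  have "(\<integral>\<^sup>+x. g x \<partial>frame_volume 0 B) = (\<integral>\<^sup>+x. g x \<partial>distr (frame_volume 0 B) borel ((+) w))"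
    using frame_volume_translate[OF assms(1,2), of 0] frame_volume_shift[of w B] by simp
  also have "\<dots> = (\<integral>\<^sup>+x. g (w + x) \<partial>frame_volume 0 B)"
    using assms(3) by (subst nn_integral_distr) auto
  finally show ?thesis ..
qed

text \<open>Both frames have the same direction space, and their base points differ by a vector of
  it. The centred measures are invariant under that space, hence proportional.\<close>

lemma frame_volume_unique:
  fixes V :: "'a::euclidean_space set"
  assumes "orthonormal_frame V c B" "orthonormal_frame V c' B'"
  shows "frame_volume c B = frame_volume c' B'"
proof -
  note B = orthonormal_frameD[OF assms(1)] and B' = orthonormal_frameD[OF assms(2)]
  have "c' \<in> V" using span_zero[of B'] by (auto simp: B'(5))
  then obtain w where w: "w \<in> span B" "c' = c + w" by (auto simp: B(5))
  have "(\<lambda>y. c + y) ` span B = (\<lambda>y. c + y) ` ((\<lambda>y. w + y) ` span B')"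
    using B(5) B'(5) by (simp add: w(2) image_image add.assoc)
  then have "span B = (\<lambda>y. w + y) ` span B'"
    by (simp add: inj_image_eq_iff)
  moreover from this obtain w' where "w' \<in> span B'" "0 = w + w'"
    using span_zero[of B] by auto
  then have w': "w \<in> span B'" using span_neg[of w' B'] by (metis add.inverse_inverse minus_unique)
  moreover have "(\<lambda>y. w + y) ` span B' = span B'"
  proof (intro set_eqI iffI)
    fix x assume "x \<in> span B'"
    then have "x - w \<in> span B'" "x = w + (x - w)" using w' by (auto intro: span_diff)
    then show "x \<in> (\<lambda>y. w + y) ` span B'" by (rule image_eqI[rotated])
  qed (use w' in \<open>auto intro: span_add\<close>)
  ultimately have span: "span B = span B'" by simp
  then have card: "card B = card B'"
    using B(2) B'(2) by (metis dim_span_eq_card_independent)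
  have eq: "frame_volume 0 B = frame_volume 0 B'"
  proof (rule measure_eqI)
    fix E assume "E \<in> sets (frame_volume 0 B)"
    then have E: "E \<in> sets borel" by simp
    \<comment> \<open>The unit ball is symmetric and has the same positive finite mass for both
      frames, so the proportionality factor is 1.\<close>
    have "emeasure (frame_volume 0 B) (cball 0 1) * emeasure (frame_volume 0 B') E =
        emeasure (frame_volume 0 B) E * emeasure (frame_volume 0 B') (cball 0 1)"
    proof (rule translation_invariant_measures_proportional[where W = "span B"])
      show "sigma_finite_measure (frame_volume 0 B)" "sigma_finite_measure (frame_volume 0 B')"
        using assms by (auto intro: sigma_finite_frame_volume)
      show "AE x in frame_volume 0 B. x \<in> span B" by (rule AE_frame_volume[OF B(1)])
      show "AE x in frame_volume 0 B'. x \<in> span B" unfolding span by (rule AE_frame_volume[OF B'(1)])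
    qed (use E B(1) B'(1) in \<open>auto intro: nn_integral_frame_volume_translate span_neg simp: span\<close>)
    then have "ennreal (unit_ball_vol (real (card B'))) * emeasure (frame_volume 0 B') E =
        ennreal (unit_ball_vol (real (card B'))) * emeasure (frame_volume 0 B) E"
      using emeasure_frame_volume_cball[OF assms(1), of 1] emeasure_frame_volume_cball[OF assms(2), of 1] card
      by (simp add: mult.commute)
    moreover have "unit_ball_vol (real (card B')) > 0" by simp
    ultimately show "emeasure (frame_volume 0 B) E = emeasure (frame_volume 0 B') E"
      by (subst (asm) ennreal_mult_cancel_left) auto
  qed simp
  have "frame_volume c' B' = frame_volume c B'"
    unfolding w(2) by (rule frame_volume_translate[OF B'(1) w'])
  also have "\<dots> = frame_volume c B"
    using eq frame_volume_shift[of c B] frame_volume_shift[of c B'] by simp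
  finally show ?thesis ..
qed

text \<open>This removes the choice in \<open>affine_volume\<close>: any frame suited to the
  computation at hand may be used.\<close>

lemma affine_volume_eq:
  assumes "orthonormal_frame V c B"
  shows "affine_volume V = frame_volume c B"
proof -
  obtain c' B' where s: "(SOME (c, B). orthonormal_frame V c B) = (c', B')" by (metis surj_pair)
  have "case (c', B') of (c, B) \<Rightarrow> orthonormal_frame V c B"
    unfolding s[symmetric] by (rule someI[of _ "(c, B)"]) (use assms in simp)
  then show ?thesis
    unfolding affine_volume_def s using frame_volume_unique[OF _ assms] by simp
qed

lemma affine_volume_UNIV: "affine_volume UNIV = (lborel :: 'a::euclidean_space measure)"
proof -
  have "orthonormal_frame (UNIV :: 'a set) 0 Basis"
    by (auto simp: orthonormal_frame_def pairwise_def orthogonal_def inner_Basis)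
  then show ?thesis
    using lborel_eq[where 'a = 'a] by (simp add: affine_volume_eq frame_volume_def)
qed

text \<open>The affine function is nonzero at the base point. Either it is constant on the flat, or
  some frame vector \<open>v\<close> changes it, and then each line in direction \<open>v\<close>
  contains a single zero, so the zero set is null by Fubini.\<close>

lemma AE_frame_volume_affine_neq:
  fixes n y :: "'a::euclidean_space"
  assumes "finite B" "n \<bullet> y + \<beta> \<noteq> 0"
  shows "AE x in frame_volume y B. n \<bullet> x + \<beta> \<noteq> 0"
proof -
  let ?P = "\<lambda>B \<tau>. n \<bullet> (y + (\<Sum>v\<in>B. \<tau> v *\<^sub>R v)) + \<beta> \<noteq> 0"
  have "AE \<tau> in Pi\<^sub>M B (\<lambda>_. lborel :: real measure). ?P B \<tau>"
  proof (cases "\<forall>v\<in>B. n \<bullet> v = 0")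
    case True
    then have "n \<bullet> (\<Sum>v\<in>B. \<tau> v *\<^sub>R v) = 0" for \<tau> :: "'a \<Rightarrow> real"
      by (simp add: inner_sum_right)
    then show ?thesis using assms(2) by (simp add: inner_add_right)
  next
    case False
    then obtain v C where B: "B = insert v C" "v \<notin> C" and nv: "n \<bullet> v \<noteq> 0"
      by (metis Set.set_insert)
    have fin: "finite C" using assms(1) B by simp
    interpret P: product_sigma_finite "\<lambda>_ :: 'a. lborel :: real measure" ..
    let ?M = "Pi\<^sub>M (insert v C) (\<lambda>_. lborel :: real measure)"
    note frame_map_measurable[of y "insert v C", measurable]
    define g :: "('a \<Rightarrow> real) \<Rightarrow> ennreal" where
      "g \<tau> = indicator {x. n \<bullet> x + \<beta> = 0} (y + (\<Sum>v\<in>insert v C. \<tau> v *\<^sub>R v))" for \<tau>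
    have g: "g \<in> borel_measurable ?M" unfolding g_def by measurable
    have "(\<integral>\<^sup>+\<tau>. g \<tau> \<partial>?M) = (\<integral>\<^sup>+\<tau>. \<integral>\<^sup>+s. g (\<tau>(v := s)) \<partial>lborel \<partial>Pi\<^sub>M C (\<lambda>_. lborel))"
      by (rule P.product_nn_integral_insert[OF fin B(2) g])
    also have "\<dots> = (\<integral>\<^sup>+\<tau>. 0 \<partial>Pi\<^sub>M C (\<lambda>_. lborel :: real measure))"
    proof (intro nn_integral_cong)
      fix \<tau> :: "'a \<Rightarrow> real"
      define r where "r = n \<bullet> (y + (\<Sum>w\<in>C. \<tau> w *\<^sub>R w)) + \<beta>"
      have eq: "n \<bullet> (y + (\<Sum>w\<in>insert v C. (\<tau>(v := s)) w *\<^sub>R w)) + \<beta> = r + s * (n \<bullet> v)" for s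
      proof -
        have "(\<Sum>w\<in>C. (\<tau>(v := s)) w *\<^sub>R w) = (\<Sum>w\<in>C. \<tau> w *\<^sub>R w)"
          using B(2) by (intro sum.cong) auto
        then show ?thesis using B(2) fin by (simp add: r_def inner_add_right)
      qed
      have "AE s in lborel. s \<noteq> - r / (n \<bullet> v)" by (rule AE_lborel_singleton)
      then have "AE s in lborel. g (\<tau>(v := s)) = 0"
      proof eventually_elim
        case (elim s)
        then have "r + s * (n \<bullet> v) \<noteq> 0" using nv by (auto simp: field_simps add_eq_0_iff)
        then show ?case using eq[of s] unfolding g_def by (simp del: fun_upd_apply)
      qed
      then have "(\<integral>\<^sup>+s. g (\<tau>(v := s)) \<partial>lborel) = (\<integral>\<^sup>+s. 0 \<partial>(lborel :: real measure))"
        by (rule nn_integral_cong_AE)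
      then show "(\<integral>\<^sup>+s. g (\<tau>(v := s)) \<partial>lborel) = 0" by simp
    qed
    finally have "AE \<tau> in ?M. g \<tau> = 0"
      using g by (simp add: nn_integral_0_iff_AE)
    then show ?thesis unfolding B(1) by eventually_elim (auto simp: g_def indicator_def split: if_splits)
  qed
  then show ?thesis unfolding frame_volume_def by (subst AE_distr_iff) auto
qed

subsection \<open>Differentiating under a moving half-space\<close>

lemma heaviside_measurable[measurable]: "heaviside \<in> borel_measurable borel"
  unfolding heaviside_def[abs_def] by measurable

lemma integrable_exp_square: "integrable lborel (\<lambda>s::real. exp (- (s\<^sup>2 / 4)))"
proof -
  have "integrable lborel (\<lambda>s. sqrt (2 * pi * (sqrt 2)\<^sup>2) * normal_density 0 (sqrt 2) s)"
    by (intro integrable_mult_right integrable_normal_density) simp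
  then show ?thesis by (simp add: normal_density_def)
qed

text \<open>The Heaviside factor cuts the integral at \<open>- t / \<delta>\<close>, so this is the
  fundamental theorem of calculus at 0 combined with the chain rule.\<close>

lemma has_derivative_heaviside_integral:
  fixes h :: "real \<Rightarrow> real"
  assumes h: "integrable lborel h" and cont: "isCont h 0" and "\<delta> > 0"
  shows "((\<lambda>t. \<integral>s. heaviside (\<delta> * s + t) * h s \<partial>lborel) has_real_derivative h 0 / \<delta>) (at 0)"
proof -
  \<comment> \<open>Starting at -1 suffices, since \<open>- t / \<delta>\<close> stays in (-1, 1)
    for \<open>t\<close> within distance \<open>\<delta>\<close> of 0.\<close>
  define G where "G v = integral {-1..v} h" for v
  have int: "set_integrable lborel A h" if "A \<in> sets borel" for A
    using h that unfolding set_integrable_def by (intro integrable_mult_indicator) auto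
  have "h integrable_on {-1..1}"
    using int[of "{-1..1}"] set_borel_integral_eq_integral(1) by auto
  then have "(G has_vector_derivative h 0) (at 0 within ({-1..1} - {}))"
    unfolding G_def by (rule integral_has_vector_derivative_continuous_at)
      (use cont in \<open>auto intro: continuous_within_subset\<close>)
  moreover have "at (0::real) within ({-1..1} - {}) = at 0"
    by (rule at_within_interior) (simp add: interior_atLeastAtMost_real)
  ultimately have "(G has_real_derivative h 0) (at 0)"
    by (simp add: has_real_derivative_iff_has_vector_derivative)
  then have G: "(G has_real_derivative h 0) (at (- 0 / \<delta>))" by simp
  have "((\<lambda>t. - t / \<delta>) has_real_derivative (- 1 / \<delta>)) (at 0)"
    using \<open>\<delta> > 0\<close> by (auto intro!: derivative_eq_intros)
  from DERIV_chain2[OF G this]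
  have "((\<lambda>t. G (- t / \<delta>)) has_real_derivative h 0 * (- 1 / \<delta>)) (at 0)" .
  then have D: "((\<lambda>t. (\<integral>s. indicator {-1..} s * h s \<partial>lborel) - G (- t / \<delta>)) has_real_derivative h 0 / \<delta>) (at 0)"
    by (auto intro!: derivative_eq_intros)
  show ?thesis
  proof (rule has_field_derivative_transform_within[OF D, of \<delta>])
    fix t :: real assume "dist t 0 < \<delta>"
    define v where "v = - t / \<delta>"
    have v: "- 1 \<le> v" using \<open>dist t 0 < \<delta>\<close> \<open>\<delta> > 0\<close> by (auto simp: v_def field_simps dist_real_def)
    have "G v = (\<integral>s. indicator {-1..v} s * h s \<partial>lborel)"
      using set_borel_integral_eq_integral(2)[OF int, of "{-1..v}"]
      by (simp add: G_def set_lebesgue_integral_def)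
    then have "(\<integral>s. indicator {-1..} s * h s \<partial>lborel) - G v =
        (\<integral>s. indicator {-1..} s * h s - indicator {-1..v} s * h s \<partial>lborel)"
      using int[of "{-1..}"] int[of "{-1..v}"]
      by (simp add: set_integrable_def)
    also have "\<dots> = (\<integral>s. heaviside (\<delta> * s + t) * h s \<partial>lborel)"
    proof (rule integral_cong_AE)
      \<comment> \<open>The two integrands treat the endpoint \<open>v\<close> differently, so that
        point is discarded.\<close>
      have "AE s in lborel. s \<noteq> v" by (rule AE_lborel_singleton)
      then show "AE s in lborel. indicator {-1..} s * h s - indicator {-1..v} s * h s = heaviside (\<delta> * s + t) * h s"
      proof eventually_elim
        case (elim s)
        have "\<delta> * s + t \<ge> 0 \<longleftrightarrow> s \<ge> v" using \<open>\<delta> > 0\<close> by (auto simp: v_def field_simps)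
        then show ?case using elim v by (auto simp: heaviside_def indicator_def)
      qed
    qed (use h in measurable)
    finally show "(\<integral>s. indicator {-1..} s * h s \<partial>lborel) - G (- t / \<delta>) =
        (\<integral>s. heaviside (\<delta> * s + t) * h s \<partial>lborel)" by (simp add: v_def)
  qed (use \<open>\<delta> > 0\<close> in auto)
qed

text \<open>A Gaussian bound centred at the base point of a frame, where it factors over the
  coordinates. It rests on the square of a sum being at most twice the sum of the squares.\<close>

lemma exp_norm_shift_bound:
  fixes c y :: "'a::real_normed_vector"
  shows "exp (- (1 / 2) * (norm (c + y))\<^sup>2) \<le> exp ((norm c)\<^sup>2 / 2) * exp (- ((norm y)\<^sup>2 / 4))"
proof -
  have "norm y \<le> norm (c + y) + norm c"
    using norm_triangle_ineq4[of "c + y" c] by simp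
  then have "(norm y)\<^sup>2 \<le> (norm (c + y) + norm c)\<^sup>2" by (intro power_mono) auto
  also have "\<dots> \<le> 2 * (norm (c + y))\<^sup>2 + 2 * (norm c)\<^sup>2"
    using zero_le_power2[of "norm (c + y) - norm c"] by (simp add: power2_eq_square algebra_simps)
  finally show ?thesis by (simp flip: exp_add)
qed

text \<open>Integrate first over the slices orthogonal to \<open>u\<close>, giving a function
  \<open>h\<close> of the coordinate \<open>s\<close> along \<open>u\<close>. The half-space depends
  on \<open>s\<close> alone, so the one-dimensional lemma applies, and \<open>h 0\<close> is the
  integral over the flat framed by \<open>B\<close>.\<close>

lemma has_derivative_half_space_integral:
  fixes q l :: "'a::euclidean_space \<Rightarrow> real"
  assumes B: "finite B" "u \<notin> B" "pairwise orthogonal (insert u B)" "\<forall>v\<in>insert u B. norm v = 1"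
    and [measurable]: "q \<in> borel_measurable borel" "l \<in> borel_measurable borel"
    and q: "\<And>x. \<bar>q x\<bar> \<le> 1"
    and cont: "AE x in frame_volume c B. isCont (\<lambda>s. q (x + s *\<^sub>R u)) 0"
    and l: "\<And>s w. w \<in> span B \<Longrightarrow> l (c + s *\<^sub>R u + w) = \<delta> * s" and "\<delta> > 0"
  shows "((\<lambda>t. \<integral>x. exp (- (1 / 2) * (norm x)\<^sup>2) * (heaviside (l x + t) * q x) \<partial>frame_volume c (insert u B))
      has_real_derivative (\<integral>x. exp (- (1 / 2) * (norm x)\<^sup>2) * q x \<partial>frame_volume c B) / \<delta>) (at 0)"
proof -
  interpret P: product_sigma_finite "\<lambda>_ :: 'a. lborel :: real measure" ..
  interpret F: finite_product_sigma_finite "\<lambda>_ :: 'a. lborel :: real measure" B by standard (rule B(1))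
  let ?M = "Pi\<^sub>M B (\<lambda>_. lborel :: real measure)" and ?M' = "Pi\<^sub>M (insert u B) (\<lambda>_. lborel :: real measure)"
  interpret pair_sigma_finite ?M "lborel :: real measure"
    by (intro pair_sigma_finite.intro F.sigma_finite_measure_axioms sigma_finite_lborel)
  note [measurable] = frame_map_measurable
  define X where "X \<tau> s = c + s *\<^sub>R u + (\<Sum>v\<in>B. \<tau> v *\<^sub>R v)" for \<tau> and s :: real
  define E where "E x = exp (- (1 / 2) * (norm x)\<^sup>2) * q x" for x :: 'a
  have [measurable]: "E \<in> borel_measurable borel" unfolding E_def by measurable
  have Xm: "(\<lambda>(\<tau>, s). X \<tau> s) \<in> borel_measurable (?M \<Otimes>\<^sub>M lborel)"
  proof -
    have "(\<lambda>z. (snd z *\<^sub>R u) + (c + (\<Sum>v\<in>B. fst z v *\<^sub>R v))) \<in> borel_measurable (?M \<Otimes>\<^sub>M lborel)"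
      by (intro borel_measurable_add measurable_compose[OF measurable_fst frame_map_measurable]) measurable
    then show ?thesis unfolding X_def case_prod_unfold by (simp add: add_ac)
  qed
  note [measurable] = Xm
  have upd: "c + (\<Sum>v\<in>insert u B. (\<tau>(u := s)) v *\<^sub>R v) = X \<tau> s" for \<tau> s
  proof -
    have "(\<Sum>v\<in>B. (\<tau>(u := s)) v *\<^sub>R v) = (\<Sum>v\<in>B. \<tau> v *\<^sub>R v)"
      using B(2) by (intro sum.cong) auto
    then show ?thesis using B(1,2) by (simp add: X_def)
  qed
  \<comment> \<open>\<open>K * (D \<tau> * exp (- (s\<^sup>2 / 4)))\<close> dominates the integrand;
    it serves both Fubini and, bounding the last factor by 1, the continuity of
    \<open>h\<close>.\<close>
  define K where "K = exp ((norm c)\<^sup>2 / 2)"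
  define D where "D \<tau> = (\<Prod>v\<in>B. exp (- ((\<tau> v)\<^sup>2 / 4)))" for \<tau> :: "'a \<Rightarrow> real"
  have D0: "D \<tau> \<ge> 0" for \<tau> unfolding D_def by (intro prod_nonneg) simp
  have K0: "K \<ge> 0" by (simp add: K_def)
  have Dint: "integrable ?M D"
    unfolding D_def by (intro P.product_integrable_prod B(1) integrable_exp_square)
  have bound: "\<bar>E (X \<tau> s)\<bar> \<le> K * (D \<tau> * exp (- (s\<^sup>2 / 4)))" for \<tau> s
  proof -
    have "X \<tau> s = c + (\<Sum>v\<in>insert u B. (\<tau>(u := s)) v *\<^sub>R v)" by (simp only: upd)
    moreover have "(norm (\<Sum>v\<in>insert u B. (\<tau>(u := s)) v *\<^sub>R v))\<^sup>2 = (\<Sum>v\<in>insert u B. ((\<tau>(u := s)) v)\<^sup>2)"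
      using B by (intro norm_orthonormal_sum) auto
    ultimately have "exp (- (1 / 2) * (norm (X \<tau> s))\<^sup>2) \<le> K * exp (- ((\<Sum>v\<in>insert u B. ((\<tau>(u := s)) v)\<^sup>2) / 4))"
      using exp_norm_shift_bound[of c "\<Sum>v\<in>insert u B. (\<tau>(u := s)) v *\<^sub>R v"] by (simp only: K_def)
    also have "(\<Sum>v\<in>insert u B. ((\<tau>(u := s)) v)\<^sup>2) = s\<^sup>2 + (\<Sum>v\<in>B. (\<tau> v)\<^sup>2)"
    proof -
      have "(\<Sum>v\<in>B. ((\<tau>(u := s)) v)\<^sup>2) = (\<Sum>v\<in>B. (\<tau> v)\<^sup>2)"
        using B(2) by (intro sum.cong) auto
      then show ?thesis using B(1,2) by simp
    qed
    also have "exp (- ((s\<^sup>2 + (\<Sum>v\<in>B. (\<tau> v)\<^sup>2)) / 4)) = D \<tau> * exp (- (s\<^sup>2 / 4))"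
      by (simp add: D_def exp_sum[OF B(1), symmetric] sum_negf sum_divide_distrib add_divide_distrib flip: exp_add)
    finally have "exp (- (1 / 2) * (norm (X \<tau> s))\<^sup>2) \<le> K * (D \<tau> * exp (- (s\<^sup>2 / 4)))" .
    moreover have "\<bar>E (X \<tau> s)\<bar> \<le> exp (- (1 / 2) * (norm (X \<tau> s))\<^sup>2)"
      unfolding E_def using q[of "X \<tau> s"] by (simp add: abs_mult mult_left_le)
    ultimately show ?thesis by linarith
  qed
  have dom: "integrable (?M \<Otimes>\<^sub>M lborel) (\<lambda>(\<tau>, s). K * (D \<tau> * exp (- (s\<^sup>2 / 4))))"
  proof (rule Fubini_integrable)
    show "(\<lambda>(\<tau>, s). K * (D \<tau> * exp (- (s\<^sup>2 / 4)))) \<in> borel_measurable (?M \<Otimes>\<^sub>M lborel)"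
      using borel_measurable_integrable[OF Dint] by measurable
    have "(\<lambda>\<tau>. \<integral>s. norm (K * (D \<tau> * exp (- (s\<^sup>2 / 4)))) \<partial>lborel) =
        (\<lambda>\<tau>. K * (D \<tau> * (\<integral>s. exp (- (s\<^sup>2 / 4)) \<partial>lborel)))"
      using D0 K0 by (simp add: abs_mult)
    then show "integrable ?M (\<lambda>\<tau>. \<integral>s. norm (case (\<tau>, s) of (\<tau>, s) \<Rightarrow> K * (D \<tau> * exp (- (s\<^sup>2 / 4)))) \<partial>lborel)"
      using Dint by simp
    show "AE \<tau> in ?M. integrable lborel (\<lambda>s. case (\<tau>, s) of (\<tau>, s) \<Rightarrow> K * (D \<tau> * exp (- (s\<^sup>2 / 4))))"
      using integrable_exp_square by simp
  qed
  have intE: "integrable (?M \<Otimes>\<^sub>M lborel) (\<lambda>(\<tau>, s). g s * E (X \<tau> s))"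
    if [measurable]: "g \<in> borel_measurable borel" and g: "\<And>s. \<bar>g s\<bar> \<le> 1" for g :: "real \<Rightarrow> real"
  proof (rule Bochner_Integration.integrable_bound[OF dom])
    show "(\<lambda>(\<tau>, s). g s * E (X \<tau> s)) \<in> borel_measurable (?M \<Otimes>\<^sub>M lborel)"
      by measurable
    have "\<bar>g s * E (X \<tau> s)\<bar> \<le> \<bar>K * (D \<tau> * exp (- (s\<^sup>2 / 4)))\<bar>" for \<tau> s
      using mult_mono[OF g[of s] bound[of \<tau> s]] D0[of \<tau>] K0 by (simp add: abs_mult)
    then show "AE z in ?M \<Otimes>\<^sub>M lborel. norm (case z of (\<tau>, s) \<Rightarrow> g s * E (X \<tau> s))
        \<le> norm (case z of (\<tau>, s) \<Rightarrow> K * (D \<tau> * exp (- (s\<^sup>2 / 4))))"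
      by (auto simp: case_prod_unfold)
  qed
  define h where "h s = (\<integral>\<tau>. E (X \<tau> s) \<partial>?M)" for s
  have h_int: "integrable lborel h"
    unfolding h_def using integrable_snd[of "\<lambda>\<tau> s. E (X \<tau> s)"] intE[of "\<lambda>_. 1"] by simp
  have h0: "h 0 = (\<integral>x. exp (- (1 / 2) * (norm x)\<^sup>2) * q x \<partial>frame_volume c B)"
    unfolding frame_volume_def h_def E_def[symmetric] by (subst integral_distr) (simp_all add: X_def)
  have h_cont: "isCont h 0"
  proof (rule continuous_at_sequentiallyI)
    fix S :: "nat \<Rightarrow> real" assume S: "S \<longlonglongrightarrow> 0"
    have "AE \<tau> in ?M. isCont (\<lambda>s. q (c + (\<Sum>v\<in>B. \<tau> v *\<^sub>R v) + s *\<^sub>R u)) 0"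
      using cont unfolding frame_volume_def by (rule AE_distrD[rotated]) measurable
    then have lim: "AE \<tau> in ?M. (\<lambda>i. E (X \<tau> (S i))) \<longlonglongrightarrow> E (X \<tau> 0)"
    proof eventually_elim
      case (elim \<tau>)
      have "isCont (\<lambda>s. E (X \<tau> s)) 0"
        unfolding E_def X_def using elim by (intro continuous_intros) (simp add: add_ac)
      then show ?case using S by (rule isCont_tendsto_compose)
    qed
    have Xs[measurable]: "(\<lambda>\<tau>. X \<tau> s) \<in> borel_measurable ?M" for s
      unfolding X_def by (rule frame_map_measurable)
    show "(\<lambda>i. h (S i)) \<longlonglongrightarrow> h 0"
      unfolding h_def
    proof (rule integral_dominated_convergence[where w = "\<lambda>\<tau>. K * D \<tau>"])
      show "AE \<tau> in ?M. norm (E (X \<tau> (S i))) \<le> K * D \<tau>" for i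
      proof (rule AE_I2)
        fix \<tau>
        have "K * (D \<tau> * exp (- ((S i)\<^sup>2 / 4))) \<le> K * (D \<tau> * 1)"
          using D0 K0 by (intro mult_left_mono) auto
        then show "norm (E (X \<tau> (S i))) \<le> K * D \<tau>" using bound[of \<tau> "S i"] by simp
      qed
    qed (use Dint lim in \<open>auto intro: borel_measurable_integrable\<close>)
  qed
  have "(\<integral>x. exp (- (1 / 2) * (norm x)\<^sup>2) * (heaviside (l x + t) * q x) \<partial>frame_volume c (insert u B))
      = (\<integral>s. heaviside (\<delta> * s + t) * h s \<partial>lborel)" for t
  proof -
    have lX: "l (X \<tau> s) = \<delta> * s" for \<tau> s
      unfolding X_def by (intro l span_sum span_scale span_base)
    let ?f = "\<lambda>x. heaviside (l x + t) * E x"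
    let ?g = "\<lambda>\<omega>. ?f (c + (\<Sum>v\<in>insert u B. \<omega> v *\<^sub>R v))"
    let ?\<phi> = "\<lambda>s. heaviside (\<delta> * s + t)"
    have i: "integrable (?M \<Otimes>\<^sub>M lborel) (\<lambda>(\<tau>, s). ?\<phi> s * E (X \<tau> s))"
      by (rule intE) (auto simp: heaviside_def)
    have [measurable]: "(\<lambda>\<omega>. c + (\<Sum>v\<in>insert u B. \<omega> v *\<^sub>R v)) \<in> borel_measurable ?M'"
      by (rule frame_map_measurable)
    \<comment> \<open>Integrability is carried over from the pair product by Tonelli, splitting off
      the coordinate of \<open>u\<close>.\<close>
    have ii: "integrable ?M' ?g"
    proof (rule integrableI_bounded)
      have "(\<integral>\<^sup>+\<omega>. ennreal (norm (?g \<omega>)) \<partial>?M') = (\<integral>\<^sup>+\<tau>. \<integral>\<^sup>+s. ennreal (norm (?g (\<tau>(u := s)))) \<partial>lborel \<partial>?M)"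
        using B(1,2) by (intro P.product_nn_integral_insert) auto
      also have "\<dots> = (\<integral>\<^sup>+\<tau>. \<integral>\<^sup>+s. ennreal (norm (?\<phi> s * E (X \<tau> s))) \<partial>lborel \<partial>?M)"
        unfolding upd lX ..
      also have "\<dots> = (\<integral>\<^sup>+z. ennreal (norm (case z of (\<tau>, s) \<Rightarrow> ?\<phi> s * E (X \<tau> s))) \<partial>(?M \<Otimes>\<^sub>M lborel))"
        using borel_measurable_integrable[OF i]
        by (subst lborel.nn_integral_fst[symmetric]) (auto simp: case_prod_unfold)
      also have "\<dots> < \<infinity>" using i by (simp only: integrable_iff_bounded)
      finally show "(\<integral>\<^sup>+\<omega>. ennreal (norm (?g \<omega>)) \<partial>?M') < \<infinity>" .
    qed measurable
    have "(\<integral>x. ?f x \<partial>frame_volume c (insert u B)) = (\<integral>\<omega>. ?g \<omega> \<partial>?M')"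
      unfolding frame_volume_def by (subst integral_distr) auto
    also have "\<dots> = (\<integral>\<tau>. \<integral>s. ?g (\<tau>(u := s)) \<partial>lborel \<partial>?M)"
      using B(1,2) ii by (rule P.product_integral_insert)
    also have "\<dots> = (\<integral>\<tau>. \<integral>s. ?\<phi> s * E (X \<tau> s) \<partial>lborel \<partial>?M)"
      unfolding upd lX ..
    also have "\<dots> = (\<integral>s. \<integral>\<tau>. ?\<phi> s * E (X \<tau> s) \<partial>?M \<partial>lborel)"
      using Fubini_integral[OF i] ..
    also have "\<dots> = (\<integral>s. ?\<phi> s * h s \<partial>lborel)" by (simp add: h_def)
    finally show ?thesis by (simp add: E_def mult_ac)
  qed
  then show ?thesis
    using has_derivative_heaviside_integral[OF h_int h_cont \<open>\<delta> > 0\<close>] by (simp add: h0)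
qed

section \<open>Face integrals, the right-hand sides of the formula, and their derivatives in
  \<open>b\<close>\<close>

definition face_integral :: "'n set \<Rightarrow> (real^'n^'d) \<times> (real^'n) \<Rightarrow> real" where
  "face_integral J = (\<lambda>(a, b). 1 / ((2 * pi) powr (real CARD('d) / 2) * sqrt (det_on J (gram a)))
           * (\<integral>x. exp (- (1 / 2) * (\<Sum>i\<in>UNIV. (x $ i)\<^sup>2))
                  * (\<Prod>j\<in>UNIV - J. heaviside (lin_fun a b j x))
                \<partial>affine_volume (V_set J a b)))"

lemma sum_square_norm: "(\<Sum>i\<in>UNIV. (x $ i)\<^sup>2) = (norm (x :: real^'d))\<^sup>2"
  unfolding power2_norm_eq_inner inner_vec_def by (simp add: power2_eq_square)

lemma lin_fun_add_axis:
  "lin_fun a (b + t *\<^sub>R axis j 1) k x = lin_fun a b k x + (if k = j then t else 0)"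
  by (simp add: lin_fun_def axis_def)

lemma lin_fun_measurable[measurable]: "lin_fun a b j \<in> borel_measurable borel"
  unfolding lin_fun_inner[abs_def] by measurable

lemma V_set_translate:
  assumes "y \<in> V_set J a b"
  shows "V_set J a b = (\<lambda>w. y + w) ` {w. \<forall>k\<in>J. column k a \<bullet> w = 0}"
proof (intro set_eqI iffI)
  fix x assume "x \<in> V_set J a b"
  then have "\<forall>k\<in>J. column k a \<bullet> (x - y) = 0"
    using assms by (simp add: V_set_def lin_fun_inner inner_diff_right) (metis add_right_cancel)
  then show "x \<in> (\<lambda>w. y + w) ` {w. \<forall>k\<in>J. column k a \<bullet> w = 0}"
    by (intro image_eqI[of _ _ "x - y"]) auto
qed (use assms in \<open>auto simp: V_set_def lin_fun_inner inner_add_right\<close>)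

text \<open>The affine function keeps its sign near \<open>s = 0\<close>, so the composition is
  locally constant.\<close>

lemma isCont_heaviside_affine:
  assumes "lin_fun a b k x \<noteq> 0"
  shows "isCont (\<lambda>s. heaviside (lin_fun a b k (x + s *\<^sub>R u))) 0"
proof -
  have eq: "lin_fun a b k (x + s *\<^sub>R u) = lin_fun a b k x + s * (column k a \<bullet> u)" for s
    by (simp add: lin_fun_inner inner_add_right)
  have "((\<lambda>s. lin_fun a b k x + s * (column k a \<bullet> u)) \<longlongrightarrow> lin_fun a b k x + 0 * (column k a \<bullet> u)) (nhds 0)"
    by (intro tendsto_intros filterlim_ident)
  then have lim: "((\<lambda>s. lin_fun a b k x + s * (column k a \<bullet> u)) \<longlongrightarrow> lin_fun a b k x) (nhds 0)"
    by simp
  have "eventually (\<lambda>s. heaviside (lin_fun a b k x + s * (column k a \<bullet> u)) = heaviside (lin_fun a b k x)) (nhds 0)"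
  proof (cases "lin_fun a b k x > 0")
    case True
    from order_tendstoD(1)[OF lim this] show ?thesis
      by eventually_elim (use True in \<open>simp add: heaviside_def\<close>)
  next
    case False
    then have "lin_fun a b k x < 0" using assms by simp
    from order_tendstoD(2)[OF lim this] this show ?thesis
      by (auto elim: eventually_mono simp: heaviside_def)
  qed
  then have "isCont (\<lambda>s. heaviside (lin_fun a b k x + s * (column k a \<bullet> u))) 0 \<longleftrightarrow> isCont (\<lambda>s. heaviside (lin_fun a b k x)) (0::real)"
    by (rule isCont_cong)
  then show ?thesis by (simp add: eq)
qed

lemma face_integral_has_derivative:
  fixes a :: "real^'n^'d" and b :: "real^'n"
  assumes reg: "regular_at K a b" and K: "insert j J \<in> K" and j: "j \<notin> J"
  shows "((\<lambda>t. face_integral J (a, b + t *\<^sub>R axis j 1)) has_real_derivative face_integral (insert j J) (a, b)) (at 0)"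
proof -
  \<comment> \<open>\<open>y\<close> is the base point of the frames of both flats, and
    \<open>v\<close> certifies that the component \<open>q\<close> below is nonzero: it is
    orthogonal to \<open>p\<close> and has product 1 with \<open>column j a\<close>.\<close>
  obtain y where y: "rel_interior_face a b (insert j J) y"
    using reg K unfolding regular_at_def by blast
  obtain v where v: "\<forall>k\<in>insert j J. column k a \<bullet> v = (if k = j then 1 else 0)"
    using reg K unfolding regular_at_def by blast
  let ?C = "(\<lambda>k. column k a) ` J"
  obtain p q where pq: "p \<in> span ?C" "\<And>w. w \<in> span ?C \<Longrightarrow> orthogonal q w" "column j a = p + q"
    using orthogonal_subspace_decomp_exists[of ?C "column j a"] by blast
  have qJ: "q \<bullet> column k a = 0" if "k \<in> J" for k
    using pq(2)[OF span_base, of "column k a"] that by (auto simp: orthogonal_def)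
  have "orthogonal v p"
    by (rule orthogonal_to_span[OF pq(1)]) (use v j in \<open>auto simp: orthogonal_def inner_commute\<close>)
  then have "q \<bullet> v = 1"
    using v pq(3) by (simp add: orthogonal_def inner_commute inner_add_right inner_add_left)
  then have "q \<noteq> 0" by auto
  define \<delta> where "\<delta> = norm q"
  define u where "u = (1 / \<delta>) *\<^sub>R q"
  have \<delta>: "\<delta> > 0" using \<open>q \<noteq> 0\<close> by (simp add: \<delta>_def)
  have q: "q = \<delta> *\<^sub>R u" using \<delta> by (simp add: u_def)
  have normu: "norm u = 1" using \<delta> by (simp add: u_def \<delta>_def)
  have uJ: "column k a \<bullet> u = 0" if "k \<in> J" for k using qJ[OF that] by (simp add: u_def inner_commute)
  have "q \<bullet> p = 0" using pq(2)[OF pq(1)] by (simp add: orthogonal_def)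
  then have "column j a \<bullet> q = \<delta> * \<delta>"
    using power2_norm_eq_inner[of q]
    by (simp add: pq(3) inner_add_left inner_commute[of p q] \<delta>_def power2_eq_square)
  then have uj: "column j a \<bullet> u = \<delta>" using \<delta> by (simp add: u_def)
  \<comment> \<open>The direction space of the smaller flat. Its orthonormal basis \<open>B\<close>,
    extended by \<open>u\<close>, frames the larger one.\<close>
  define W where "W = {w. \<forall>k\<in>insert j J. column k a \<bullet> w = 0}"
  have "subspace W"
    unfolding W_def by (auto simp: subspace_def inner_add_right)
  then obtain B where B: "B \<subseteq> W" "pairwise orthogonal B" "\<And>x. x \<in> B \<Longrightarrow> norm x = 1" "independent B" "span B = W"
    using orthonormal_basis_subspace by metis
  have uW: "u \<bullet> w = 0" if "w \<in> W" for w
  proof -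
    have "orthogonal w p"
      by (rule orthogonal_to_span[OF pq(1)]) (use that in \<open>auto simp: W_def orthogonal_def inner_commute\<close>)
    moreover have "column j a \<bullet> w = 0" using that by (auto simp: W_def)
    ultimately show ?thesis
      by (simp add: pq(3) u_def orthogonal_def inner_commute inner_add_right inner_add_left)
  qed
  have finB: "finite B" using B(4) by (rule independent_imp_finite)
  have uB: "u \<notin> B" using uW B(1) normu by (metis inner_eq_zero_iff norm_zero subsetD zero_neq_one)
  have orthB: "pairwise orthogonal (insert u B)"
    using B(1,2) uW by (auto simp: pairwise_insert orthogonal_def inner_commute)
  have yV: "y \<in> V_set (insert j J) a b" "y \<in> V_set J a b"
    using y by (auto simp: rel_interior_face_def V_set_def)
  have frame': "orthonormal_frame (V_set (insert j J) a b) y B"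
    unfolding orthonormal_frame_def V_set_translate[OF yV(1)] B(5) W_def using B(2,3) by auto
  have "{w. \<forall>k\<in>J. column k a \<bullet> w = 0} = span (insert u B)"
  proof (intro set_eqI iffI)
    fix w assume w: "w \<in> {w. \<forall>k\<in>J. column k a \<bullet> w = 0}"
    have "orthogonal w p"
      by (rule orthogonal_to_span[OF pq(1)]) (use w in \<open>auto simp: orthogonal_def inner_commute\<close>)
    then have "column j a \<bullet> w = \<delta> * (u \<bullet> w)"
      by (simp add: pq(3) q orthogonal_def inner_commute inner_add_left inner_add_right)
    \<comment> \<open>Since \<open>column j a \<bullet> u = \<delta>\<close>, removing the
      \<open>u\<close>-component annihilates the \<open>j\<close>-th normal as well.\<close>
    then have "w - (u \<bullet> w) *\<^sub>R u \<in> W"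
      using w uJ uj by (auto simp: W_def inner_diff_right)
    then show "w \<in> span (insert u B)" unfolding span_insert B(5) by blast
  next
    fix w assume "w \<in> span (insert u B)"
    then obtain k where "w - k *\<^sub>R u \<in> W" unfolding span_insert B(5) by blast
    then have "\<forall>i\<in>J. column i a \<bullet> w = k * (column i a \<bullet> u)"
      by (auto simp: W_def inner_diff_right)
    then show "w \<in> {w. \<forall>k\<in>J. column k a \<bullet> w = 0}" using uJ by simp
  qed
  then have frame: "orthonormal_frame (V_set J a b) y (insert u B)"
    unfolding orthonormal_frame_def V_set_translate[OF yV(2)] using orthB B(3) normu by auto
  define Q where "Q x = (\<Prod>k\<in>UNIV - insert j J. heaviside (lin_fun a b k x))" for x
  have [measurable]: "Q \<in> borel_measurable borel" unfolding Q_def by measurable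
  have "((\<lambda>t. \<integral>x. exp (- (1 / 2) * (norm x)\<^sup>2) * (heaviside (lin_fun a b j x + t) * Q x) \<partial>frame_volume y (insert u B))
      has_real_derivative (\<integral>x. exp (- (1 / 2) * (norm x)\<^sup>2) * Q x \<partial>frame_volume y B) / \<delta>) (at 0)"
  proof (rule has_derivative_half_space_integral)
    show "\<bar>Q x\<bar> \<le> 1" for x
      unfolding Q_def abs_prod by (intro prod_le_1) (auto simp: heaviside_def)
    \<comment> \<open>No other bounding hyperplane contains the flat, because \<open>y\<close> is
      off all of them; so almost everywhere \<open>Q\<close> is continuous in the direction
      \<open>u\<close>.\<close>
    have "AE x in frame_volume y B. lin_fun a b k x \<noteq> 0" if "k \<notin> insert j J" for k
    proof -
      have "lin_fun a b k y \<noteq> 0" using y that unfolding rel_interior_face_def by fastforce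
      then show ?thesis unfolding lin_fun_inner by (rule AE_frame_volume_affine_neq[OF finB])
    qed
    then have "AE x in frame_volume y B. \<forall>k\<in>UNIV - insert j J. lin_fun a b k x \<noteq> 0"
      by (intro AE_finite_allI) auto
    then show "AE x in frame_volume y B. isCont (\<lambda>s. Q (x + s *\<^sub>R u)) 0"
    proof eventually_elim
      case (elim x)
      then show ?case unfolding Q_def by (intro continuous_prod isCont_heaviside_affine) auto
    qed
    show "lin_fun a b j (y + s *\<^sub>R u + w) = \<delta> * s" if "w \<in> span B" for s w
    proof -
      have "column j a \<bullet> w = 0" using that unfolding B(5) W_def by auto
      moreover have "lin_fun a b j y = 0" using y by (auto simp: rel_interior_face_def)
      ultimately show ?thesis by (simp add: lin_fun_inner inner_add_right uj)
    qed
  qed (use finB uB orthB B(3) normu \<delta> in auto)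
  then have D: "((\<lambda>t. 1 / ((2 * pi) powr (real CARD('d) / 2) * sqrt (det_on J (gram a))) *
        (\<integral>x. exp (- (1 / 2) * (norm x)\<^sup>2) * (heaviside (lin_fun a b j x + t) * Q x) \<partial>frame_volume y (insert u B)))
      has_real_derivative 1 / ((2 * pi) powr (real CARD('d) / 2) * sqrt (det_on J (gram a))) *
        ((\<integral>x. exp (- (1 / 2) * (norm x)\<^sup>2) * Q x \<partial>frame_volume y B) / \<delta>)) (at 0)"
    by (rule DERIV_cmult)
  have "face_integral J (a, b + t *\<^sub>R axis j 1) =
      1 / ((2 * pi) powr (real CARD('d) / 2) * sqrt (det_on J (gram a))) *
        (\<integral>x. exp (- (1 / 2) * (norm x)\<^sup>2) * (heaviside (lin_fun a b j x + t) * Q x) \<partial>frame_volume y (insert u B))" for t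
  proof -
    \<comment> \<open>As \<open>j\<close> is not in \<open>J\<close>, varying the
      \<open>j\<close>-th component of \<open>b\<close> fixes the flat and moves only one
      half-space.\<close>
    have V: "V_set J a (b + t *\<^sub>R axis j 1) = V_set J a b"
      using j by (auto simp: V_set_def lin_fun_add_axis)
    have "(\<Prod>k\<in>UNIV - J. heaviside (lin_fun a (b + t *\<^sub>R axis j 1) k x)) = heaviside (lin_fun a b j x + t) * Q x" for x
    proof -
      have "UNIV - J = insert j (UNIV - insert j J)" using j by auto
      then have "(\<Prod>k\<in>UNIV - J. heaviside (lin_fun a (b + t *\<^sub>R axis j 1) k x)) =
          heaviside (lin_fun a b j x + t) * (\<Prod>k\<in>UNIV - insert j J. heaviside (lin_fun a (b + t *\<^sub>R axis j 1) k x))"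
        by (simp add: lin_fun_add_axis)
      also have "(\<Prod>k\<in>UNIV - insert j J. heaviside (lin_fun a (b + t *\<^sub>R axis j 1) k x)) = Q x"
        unfolding Q_def by (intro prod.cong) (auto simp: lin_fun_add_axis)
      finally show ?thesis .
    qed
    then show ?thesis
      unfolding face_integral_def prod.case V affine_volume_eq[OF frame] sum_square_norm by simp
  qed
  moreover have "face_integral (insert j J) (a, b) =
      1 / ((2 * pi) powr (real CARD('d) / 2) * sqrt (det_on J (gram a))) *
        ((\<integral>x. exp (- (1 / 2) * (norm x)\<^sup>2) * Q x \<partial>frame_volume y B) / \<delta>)"
  proof -
    \<comment> \<open>The factor \<open>1 / \<delta>\<close> from the derivative is exactly the
      change of the Gram normalization.\<close>
    have "sqrt (det_on (insert j J) (gram a)) = \<delta> * sqrt (det_on J (gram a))"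
      using det_on_gram_insert[OF j pq(3,1) qJ] by (simp add: real_sqrt_mult \<delta>_def norm_eq_sqrt_inner)
    then show ?thesis
      unfolding face_integral_def prod.case affine_volume_eq[OF frame'] sum_square_norm Q_def[symmetric]
      by simp
  qed
  ultimately show ?thesis using D by simp
qed

section \<open>Iterated derivatives and the conclusion\<close>

lemma regular_at_downward:
  assumes "regular_at K a b" "insert j J \<in> K"
  shows "J \<in> K"
proof -
  obtain y where y: "rel_interior_face a b (insert j J) y"
    using assms unfolding regular_at_def by blast
  have "lin_fun a b k y \<ge> 0" for k
    using y unfolding rel_interior_face_def by (cases "k \<in> insert j J") (auto intro: less_imp_le)
  then have "on_face a b J y" using y by (auto simp: on_face_def rel_interior_face_def)
  then show ?thesis using assms(1) unfolding regular_at_def by blast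
qed

text \<open>The starting point \<open>J = {}\<close>: the sum over faces becomes the product of
  Heaviside functions, the flat is the whole space and its volume is Lebesgue measure.\<close>

lemma phi_eq_face_integral:
  fixes a :: "real^'n^'d" and b :: "real^'n"
  assumes reg: "regular_at K a b" and "{} \<in> K"
  shows "phi K (a, b) = face_integral {} (a, b)"
proof -
  have "(\<Sum>F\<in>K. \<Prod>j\<in>F. (heaviside (lin_fun a b j x) - 1)) = (\<Prod>j\<in>UNIV. heaviside (lin_fun a b j x))" for x
  proof (rule sum_heaviside_faces)
    show "lin_fun a b j ((1 - t) *\<^sub>R x + t *\<^sub>R y) = (1 - t) * lin_fun a b j x + t * lin_fun a b j y" for j x y t
      by (simp add: lin_fun_inner inner_add_right algebra_simps)
    show "\<exists>y. (\<forall>j\<in>L. lin_fun a b j y = 0) \<and> (\<forall>j. j \<notin> L \<longrightarrow> lin_fun a b j y > 0)" if "L \<in> K" for L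
      using reg that unfolding regular_at_def rel_interior_face_def by blast
    show "L \<in> K" if "\<forall>j. lin_fun a b j x \<ge> 0" "\<forall>j\<in>L. lin_fun a b j x = 0" for L x
      using reg that unfolding regular_at_def on_face_def by blast
  qed (rule \<open>{} \<in> K\<close>)
  moreover have "V_set {} a b = UNIV" by (simp add: V_set_def)
  moreover have "det_on {} (gram a) = 1" by (simp add: det_on_def)
  ultimately show ?thesis
    by (simp add: phi_def face_integral_def affine_volume_UNIV flip: integral_mult_right_zero)
qed

text \<open>Induction on \<open>js\<close>, for all parameters of \<open>U\<close> at once, since
  each derivative needs the formula at nearby parameters.\<close>

lemma iter_partial_phi:
  fixes U :: "((real^'n^'d) \<times> (real^'n)) set"
  assumes "open U" and reg: "\<forall>(a, b)\<in>U. regular_at K a b"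
    and "{} \<in> K" "U \<noteq> {}" "distinct js" "set js \<in> K"
  shows "iter_partials_exist js (phi K) U \<and> (\<forall>p\<in>U. iter_partial_b js (phi K) p = face_integral (set js) p)"
  using assms(5,6)
proof (induction js)
  case Nil
  then show ?case using reg \<open>{} \<in> K\<close> by (auto intro!: phi_eq_face_integral)
next
  case (Cons j js)
  \<comment> \<open>Any regular parameter shows that the smaller index set is again in
    \<open>K\<close>.\<close>
  obtain a1 b1 where "(a1, b1) \<in> U" using \<open>U \<noteq> {}\<close> by auto
  then have "set js \<in> K" using reg Cons.prems regular_at_downward[of K a1 b1 j "set js"] by auto
  then have IH: "iter_partials_exist js (phi K) U" "\<And>p. p \<in> U \<Longrightarrow> iter_partial_b js (phi K) p = face_integral (set js) p"
    using Cons.IH Cons.prems by auto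
  have D: "((\<lambda>t. iter_partial_b js (phi K) (a, b + t *\<^sub>R axis j 1)) has_real_derivative
      face_integral (set (j # js)) (a, b)) (at 0)" if ab: "(a, b) \<in> U" for a b
  proof -
    \<comment> \<open>Openness keeps the shifted parameter in \<open>U\<close> for small
      \<open>t\<close>, so the induction hypothesis replaces the iterated derivative by a face
      integral near \<open>t = 0\<close>.\<close>
    have "((\<lambda>t. (a, b + t *\<^sub>R axis j 1)) \<longlongrightarrow> (a, b + 0 *\<^sub>R axis j 1)) (nhds (0::real))"
      by (intro tendsto_intros filterlim_ident)
    then have "eventually (\<lambda>t::real. (a, b + t *\<^sub>R axis j 1) \<in> U) (nhds 0)"
      using \<open>open U\<close> ab by (auto dest: topological_tendstoD)
    then have "eventually (\<lambda>t. iter_partial_b js (phi K) (a, b + t *\<^sub>R axis j 1) =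
        face_integral (set js) (a, b + t *\<^sub>R axis j 1)) (nhds 0)"
      by (rule eventually_mono) (rule IH(2))
    moreover have "((\<lambda>t. face_integral (set js) (a, b + t *\<^sub>R axis j 1)) has_real_derivative
        face_integral (insert j (set js)) (a, b)) (at 0)"
      by (rule face_integral_has_derivative) (use reg ab Cons.prems in auto)
    ultimately show ?thesis by (subst DERIV_cong_ev[OF refl _ refl]) auto
  qed
  show ?case
    using IH(1) D DERIV_imp_deriv[OF D]
    by (auto simp: has_partial_b_def partial_b_def field_differentiable_def simp del: set_simps)
qed

theorem theorem7:
  fixes a0 :: "real^'n^'d" and b0 :: "real^'n" and J :: "'n set"
  assumes "bounding_half_spaces a0 b0"
    and "general_position a0 b0"
    and "J \<in> simp_complex a0 b0"
  shows "\<exists>U. open U \<and> (a0, b0) \<in> U \<and>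
    (\<forall>js. distinct js \<and> set js = J \<longrightarrow>
      iter_partials_exist js (phi (simp_complex a0 b0)) U \<and>
      (\<forall>(a, b)\<in>U.
         iter_partial_b js (phi (simp_complex a0 b0)) (a, b)
         = 1 / ((2 * pi) powr (real CARD('d) / 2) * sqrt (det_on J (gram a)))
           * (\<integral>x. exp (- (1 / 2) * (\<Sum>i\<in>UNIV. (x $ i)\<^sup>2))
                  * (\<Prod>j\<in>UNIV - J. heaviside (lin_fun a b j x))
                \<partial>affine_volume (V_set J a b))))"
proof -
  have "P_set a0 b0 \<noteq> {}"
    using assms(1) interior_subset[of "P_set a0 b0"] by (auto simp: bounding_half_spaces_def)
  \<comment> \<open>\<open>U\<close> consists of regular parameters and serves every ordering
    \<open>js\<close> of \<open>J\<close>.\<close>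
  then obtain U where U: "open U" "(a0, b0) \<in> U" "\<forall>(a, b)\<in>U. regular_at (simp_complex a0 b0) a b"
    using regular_neighbourhood[OF assms(2)] by blast
  have "{} \<in> simp_complex a0 b0" by (simp add: simp_complex_def)
  from iter_partial_phi[OF U(1,3) this] U(2) assms(3)
  have "iter_partials_exist js (phi (simp_complex a0 b0)) U \<and>
      (\<forall>p\<in>U. iter_partial_b js (phi (simp_complex a0 b0)) p = face_integral J p)"
    if "distinct js" "set js = J" for js
    using that by blast
  then show ?thesis
    using U(1,2) unfolding face_integral_def by (intro exI[of _ U]) auto
qed

end
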